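(* Let $\mathbb{T}$ be a bounded time scale, $a:=\min\mathbb{T}$, $b:=\max\mathbb{T}$, and let $f:\mathbb{T}_{\kappa}\times\mathbb{R}^{n}\to\mathbb{R}^{n}$ be continuous. If $(v,M)\in C^{1}_{ld}(\mathbb{T},\mathbb{R}^{n})\times C^{1}_{ld}(\mathbb{T},[0,+\infty))$ is a tube solution of the problem $$x^{\nabla}(t)=f(t,x(t)),\quad t\in\mathbb{T}_{\kappa},\qquad x(a)=x(b),$$ then this problem has a solution $x\in C^{1}_{ld}(\mathbb{T},\mathbb{R}^{n})$ satisfying $\|x(t)-v(t)\|\le M(t)$ for every $t\in\mathbb{T}$.
   Context: A time scale $\mathbb{T}$ is a nonempty closed subset of $\mathbb{R}$. The jump operators are $\sigma(t)=\inf\{s\in\mathbb{T}:s>t\}$ and $\rho(t)=\sup\{s\in\mathbb{T}:s<t\}$, with the usual conventions $\sigma(\max\mathbb{T})=\max\mathbb{T}$, $\rho(\min\mathbb{T})=\min\mathbb{T}$. A point $t$ is left-scattered if $\rho(t)<t$, right-scattered if $\sigma(t)>t$, left-dense if $t>\inf\mathbb{T}$ and $\rho(t)=t$, right-dense if $t<\sup\mathbb{T}$ and $\sigma(t)=t$. If $\mathbb{T}$ has a right-scattered minimum $m$, then $\mathbb{T}_{\kappa}:=\mathbb{T}\setminus\{m\}$; otherwise $\mathbb{T}_{\kappa}:=\mathbb{T}$. For $h:\mathbb{T}\to\mathbb{R}^{n}$ and $t\in\mathbb{T}_{\kappa}$, the nabla derivative $h^{\nabla}(t)$ is (if it exists)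 the element of $\mathbb{R}^n$ such that for every $\epsilon>0$ there is a neighborhood $U$ of $t$ in $\mathbb{T}$ with $\|h(\rho(t))-h(s)-h^{\nabla}(t)[\rho(t)-s]\|\le\epsilon|\rho(t)-s|$ for all $s\in U$. A function is ld-continuous if it is continuous at left-dense points and has finite right-sided limits at right-dense points. $C^{1}_{ld}(\mathbb{T},E)$ denotes the set of functions $h:\mathbb{T}\to E$ that are nabla differentiable at every $t\in\mathbb{T}_{\kappa}$ and whose nabla derivative is ld-continuous. $\|\cdot\|$ and $\langle\cdot,\cdot\rangle$ are the Euclidean norm and inner product on $\mathbb{R}^{n}$. A solution of the problem is a function $x\in C^{1}_{ld}(\mathbb{T},\mathbb{R}^{n})$ satisfying the equation for all $t\in\mathbb{T}_\kappa$ and the boundary condition. A pair $(v,M)\in C^{1}_{ld}(\mathbb{T},\mathbb{R}^{n})\times C^{1}_{ld}(\mathbb{T},[0,+\infty))$ is a tube solution of the problem if: (1) $\langle x-v(t),f(t,x)-v^{\nabla}(t)\rangle+M(t)\|x-v(t)\|\le M(t)M^{\nabla}(t)$ for every $t\in\mathbb{T}_{\kappa}$ and every $x\in\mathbb{R}^{n}$ such that $\|x-v(t)\|=M(t)$; (2) $v^{\nabla}(t)=f(t,v(t))$ and $\|x-v(t)\|-M^{\nabla}(t)<0$ for every $x\in\mathbb{R}^n$ and every $t\in\mathbb{T}_{\kappa}$ such that $M(t)=0$; (3) $\|v(a)-v(b)\|\le M(a)-M(b)$. *)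

theory Defs
  imports "HOL-Analysis.Analysis"
begin

text \<open>Functions on a time scale \<open>T\<close> are total functions on the reals; only their values on
  \<open>T\<close> (for \<open>f\<close> and for derivatives: on \<open>nabla_domain T\<close>) are ever used.\<close>

definition time_scale :: "real set \<Rightarrow> bool" where
  "time_scale T \<longleftrightarrow> T \<noteq> {} \<and> closed T"

definition forward_jump :: "real set \<Rightarrow> real \<Rightarrow> real" where
  "forward_jump T t = (if {s \<in> T. s > t} = {} then t else Inf {s \<in> T. s > t})"

definition backward_jump :: "real set \<Rightarrow> real \<Rightarrow> real" where
  "backward_jump T t = (if {s \<in> T. s < t} = {} then t else Sup {s \<in> T. s < t})"

text \<open>The conditions \<open>t > inf T\<close> and \<open>t < sup T\<close> are spelled out so that they are also
  meaningful for unbounded \<open>T\<close>.\<close>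

definition left_dense :: "real set \<Rightarrow> real \<Rightarrow> bool" where
  "left_dense T t \<longleftrightarrow> (\<exists>s\<in>T. s < t) \<and> backward_jump T t = t"

definition right_dense :: "real set \<Rightarrow> real \<Rightarrow> bool" where
  "right_dense T t \<longleftrightarrow> (\<exists>s\<in>T. t < s) \<and> forward_jump T t = t"

text \<open>\<open>T\<close> without its right-scattered minimum, if it has one.\<close>

definition nabla_domain :: "real set \<Rightarrow> real set" where
  "nabla_domain T = T - {m \<in> T. (\<forall>s\<in>T. m \<le> s) \<and> forward_jump T m > m}"

definition has_nabla_derivative ::
    "real set \<Rightarrow> (real \<Rightarrow> 'a::real_normed_vector) \<Rightarrow> 'a \<Rightarrow> real \<Rightarrow> bool" where
  "has_nabla_derivative T h D t \<longleftrightarrow>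
     (\<forall>\<epsilon>>0. \<exists>U. openin (top_of_set T) U \<and> t \<in> U \<and>
        (\<forall>s\<in>U. norm (h (backward_jump T t) - h s - (backward_jump T t - s) *\<^sub>R D)
               \<le> \<epsilon> * \<bar>backward_jump T t - s\<bar>))"

text \<open>Uniqueness is part of differentiability because the derivative is defined as \<^emph>\<open>the\<close>
  element with the above property. On \<open>nabla_domain T\<close> it is automatic, except when \<open>T\<close> is a
  single point: there every vector has the property, and no nabla derivative is defined.\<close>

definition nabla_differentiable ::
    "real set \<Rightarrow> (real \<Rightarrow> 'a::real_normed_vector) \<Rightarrow> real \<Rightarrow> bool" where
  "nabla_differentiable T h t \<longleftrightarrow> (\<exists>!D. has_nabla_derivative T h D t)"

definition nabla_deriv ::
    "real set \<Rightarrow> (real \<Rightarrow> 'a::real_normed_vector) \<Rightarrow> real \<Rightarrow> 'a" where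
  "nabla_deriv T h t = (THE D. has_nabla_derivative T h D t)"

text \<open>\<open>S\<close> is the domain of \<open>g\<close>, in applications \<open>nabla_domain T\<close>; the classification of
  points always refers to \<open>T\<close>.\<close>

definition ld_continuous_on ::
    "real set \<Rightarrow> real set \<Rightarrow> (real \<Rightarrow> 'a::real_normed_vector) \<Rightarrow> bool" where
  "ld_continuous_on T S g \<longleftrightarrow>
     (\<forall>t\<in>S. left_dense T t \<longrightarrow> continuous (at t within S) g) \<and>
     (\<forall>t\<in>S. right_dense T t \<longrightarrow> (\<exists>l. (g \<longlongrightarrow> l) (at t within (S \<inter> {t<..}))))"

definition C1_ld :: "real set \<Rightarrow> 'a::real_normed_vector set \<Rightarrow> (real \<Rightarrow> 'a) set" where
  "C1_ld T E = {h. (\<forall>t\<in>T. h t \<in> E) \<and>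
                   (\<forall>t\<in>nabla_domain T. nabla_differentiable T h t) \<and>
                   ld_continuous_on T (nabla_domain T) (nabla_deriv T h)}"

definition periodic_solution ::
    "real set \<Rightarrow> real \<Rightarrow> real \<Rightarrow> (real \<Rightarrow> real^'n \<Rightarrow> real^'n) \<Rightarrow> (real \<Rightarrow> real^'n) \<Rightarrow> bool" where
  "periodic_solution T a b f x \<longleftrightarrow>
     x \<in> C1_ld T UNIV \<and>
     (\<forall>t\<in>nabla_domain T. nabla_deriv T x t = f t (x t)) \<and>
     x a = x b"

definition tube_solution ::
    "real set \<Rightarrow> real \<Rightarrow> real \<Rightarrow> (real \<Rightarrow> real^'n \<Rightarrow> real^'n) \<Rightarrow>
     (real \<Rightarrow> real^'n) \<Rightarrow> (real \<Rightarrow> real) \<Rightarrow> bool" where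
  "tube_solution T a b f v M \<longleftrightarrow>
     v \<in> C1_ld T UNIV \<and> M \<in> C1_ld T {0..} \<and>
     (\<forall>t\<in>nabla_domain T. \<forall>x. norm (x - v t) = M t \<longrightarrow>
        (x - v t) \<bullet> (f t x - nabla_deriv T v t) + M t * norm (x - v t)
          \<le> M t * nabla_deriv T M t) \<and>
     (\<forall>t\<in>nabla_domain T. M t = 0 \<longrightarrow>
        nabla_deriv T v t = f t (v t) \<and> (\<forall>x. norm (x - v t) - nabla_deriv T M t < 0)) \<and>
     norm (v a - v b) \<le> M a - M b"

end

theory Submission
  imports Defs "HOL-Complex_Analysis.Great_Picard"
begin

text \<open>
  Let \<open>P t\<close> be the radial projection onto the ball with centre \<open>v t\<close> and radius \<open>M t\<close>, and consider
  the modified problem \<open>x\<^sup>\<nabla>(t) = f(t, P t (x t))\<close>, \<open>x a = P a (x b)\<close>, whose right-hand sides are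
  bounded. As an integral equation it has a solution by a Schauder fixed point argument. If
  \<open>norm (x - v) - M\<close> had a positive maximum, at \<open>t\<close> say, then with \<open>u\<close> the unit vector in the
  direction of \<open>x t - v t\<close> the tube condition at \<open>v t + M t u\<close> shows that the nabla derivative of
  \<open>u \<bullet> (x - v) - M\<close> at \<open>t\<close> is at most \<open>- M t < 0\<close>, so the function is larger somewhere to the left
  of \<open>t\<close>. Hence \<open>x\<close> stays in the tube and solves the original equation, and
  \<open>norm (v a - v b) \<le> M a - M b\<close> puts \<open>x b\<close> into the ball at \<open>a\<close>, so that \<open>x a = x b\<close>.
\<close>

section \<open>A Schauder theorem for equicontinuous operators\<close>

text \<open>Brouwer's theorem in the library is for types of class \<open>euclidean_space\<close>; here the dimension
  \<open>card I\<close> has to vary within a proof, so we return to Kuhn's combinatorial lemma.\<close>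

lemma approximate_fixed_point_finite:
  fixes \<Phi> :: "('i \<Rightarrow> real) \<Rightarrow> 'i \<Rightarrow> real"
  assumes "finite I" and "0 < R" and "0 < e"
    and bound: "\<And>y i. \<forall>j\<in>I. \<bar>y j\<bar> \<le> R \<Longrightarrow> i \<in> I \<Longrightarrow> \<bar>\<Phi> y i\<bar> \<le> R"
    and unif: "\<And>\<epsilon>. 0 < \<epsilon> \<Longrightarrow> \<exists>\<delta>>0. \<forall>y z. (\<forall>j\<in>I. \<bar>y j\<bar> \<le> R \<and> \<bar>z j\<bar> \<le> R \<and> \<bar>y j - z j\<bar> \<le> \<delta>)
                  \<longrightarrow> (\<forall>i\<in>I. \<bar>\<Phi> y i - \<Phi> z i\<bar> \<le> \<epsilon>)"
  obtains y where "\<forall>i\<in>I. \<bar>y i\<bar> \<le> R" and "\<forall>i\<in>I. \<bar>\<Phi> y i - y i\<bar> \<le> e"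
proof -
  obtain d where "d > 0"
    and d: "\<And>y z i. \<lbrakk>\<And>j. j \<in> I \<Longrightarrow> \<bar>y j\<bar> \<le> R; \<And>j. j \<in> I \<Longrightarrow> \<bar>z j\<bar> \<le> R;
             \<And>j. j \<in> I \<Longrightarrow> \<bar>y j - z j\<bar> \<le> d; i \<in> I\<rbrakk> \<Longrightarrow> \<bar>\<Phi> y i - \<Phi> z i\<bar> \<le> e / 2"
    using unif[of "e/2"] \<open>0 < e\<close> by (metis half_gt_zero)
  define n where "n = card I"
  obtain b where b: "bij_betw b {..<n} I"
    using ex_bij_betw_nat_finite[OF \<open>finite I\<close>] by (auto simp: n_def atLeast0LessThan)
  define c where "c = the_inv_into {..<n} b"
  have cb: "c (b i) = i" if "i < n" for i
    using b that by (auto simp: c_def bij_betw_def the_inv_into_f_f)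
  have bI: "b i \<in> I" if "i < n" for i
    using b that by (auto simp: bij_betw_def)
  have c: "c j < n" "b (c j) = j" if "j \<in> I" for j
    using b that by (auto simp: c_def bij_betw_def f_the_inv_into_f dest: the_inv_into_into)
  \<comment> \<open>The grid with \<open>p\<close> steps per side of the cube has mesh
    \<open>2 * R / p\<close>. It must be at most \<open>d\<close>, so that \<open>\<Phi>\<close>
    varies by at most \<open>e / 2\<close> over a cell, and at most \<open>e / 2\<close>, since the
    points of the cell vary as well.\<close>
  obtain p :: nat where p: "2 * R / min d (e / 2) < p"
    using reals_Archimedean2 by blast
  have "0 < min d (e / 2)" using \<open>0 < d\<close> \<open>0 < e\<close> by auto
  have "0 < 2 * R / min d (e / 2)" using \<open>0 < d\<close> \<open>0 < e\<close> \<open>0 < R\<close> by simp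
  with p have "0 < p" by (metis less_trans of_nat_0_less_iff)
  have "2 * R / p < min d (e / 2)"
    using p \<open>0 < p\<close> \<open>0 < min d (e/2)\<close>
    by (metis mult.commute of_nat_0_less_iff pos_divide_less_eq)
  then have mesh: "2 * R / p \<le> d" "2 * R / p \<le> e / 2" by auto
  define Y where "Y x j = - R + 2 * R * real (x (c j)) / p" for x :: "nat \<Rightarrow> nat" and j
  have YR: "\<bar>Y x j\<bar> \<le> R" if "\<forall>i<n. x i \<le> p" "j \<in> I" for x j
  proof -
    have "x (c j) \<le> p" using that c by blast
    then have "2 * R * real (x (c j)) / p \<le> 2 * R" "0 \<le> 2 * R * real (x (c j)) / p"
      using \<open>0 < p\<close> \<open>0 < R\<close> by (auto simp: divide_simps)
    then show ?thesis unfolding Y_def by linarith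
  qed
  \<comment> \<open>Label 0 says that \<open>\<Phi>\<close> does not lower the coordinate, label 1
    that it does not raise it. Kuhn's lemma prescribes 0 on the face \<open>x i = 0\<close>, which
    is consistent because the coordinate is \<open>- R\<close> there; on the opposite face it is
    \<open>R\<close>, which \<open>\<Phi>\<close> cannot exceed.\<close>
  define label where "label x i = (if x i = 0 \<or> Y x (b i) < \<Phi> (Y x) (b i) then 0 else 1 :: nat)"
    for x i
  have label_p: "label x i = 1" if x: "\<forall>i<n. x i \<le> p" and "i < n" and "x i = p" for x i
  proof -
    have "\<Phi> (Y x) (b i) \<le> R" using bound[of "Y x" "b i"] YR[OF x] bI[OF \<open>i < n\<close>] by fastforce
    moreover have "Y x (b i) = R" using that \<open>0 < p\<close> by (simp add: Y_def cb)
    ultimately show ?thesis using \<open>0 < p\<close> that by (auto simp: label_def)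
  qed
  have label_01: "label x i = 0 \<or> label x i = 1" "x i = 0 \<Longrightarrow> label x i = 0" for x i
    by (auto simp: label_def)
  \<comment> \<open>In every coordinate the cell with lowest corner \<open>q\<close> has vertices of
    both labels; the two vertices may depend on the coordinate.\<close>
  obtain q where q: "\<forall>i<n. q i < p"
    and rs: "\<forall>i<n. \<exists>r s. (\<forall>j<n. q j \<le> r j \<and> r j \<le> q j + 1) \<and> (\<forall>j<n. q j \<le> s j \<and> s j \<le> q j + 1)
                \<and> label r i \<noteq> label s i"
    by (rule kuhn_lemma[of p n label]) (use \<open>0 < p\<close> label_p label_01 in blast)+
  have close: "\<bar>\<Phi> (Y q) j - \<Phi> (Y r) j\<bar> \<le> e / 2" "\<bar>Y q j - Y r j\<bar> \<le> e / 2" "\<forall>i<n. r i \<le> p"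
    if r: "\<forall>j<n. q j \<le> r j \<and> r j \<le> q j + 1" and "j \<in> I" for r j
  proof -
    have rp: "\<forall>i<n. r i \<le> p" using r q by (metis Suc_eq_plus1 Suc_leI le_trans)
    have qp: "\<forall>i<n. q i \<le> p" using q by (auto intro: less_imp_le)
    have Yd: "\<bar>Y q k - Y r k\<bar> \<le> 2 * R / p" if "k \<in> I" for k
    proof -
      have "\<bar>real (q (c k)) - real (r (c k))\<bar> \<le> 1" using r c(1)[OF that] by fastforce
      moreover have "Y q k - Y r k = 2 * R / p * (real (q (c k)) - real (r (c k)))"
        by (simp add: Y_def diff_divide_distrib right_diff_distrib)
      ultimately show ?thesis
        using \<open>0 < R\<close> by (simp add: abs_mult mult_left_le divide_right_mono)
    qed
    show "\<forall>i<n. r i \<le> p" by (fact rp)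
    show "\<bar>\<Phi> (Y q) j - \<Phi> (Y r) j\<bar> \<le> e / 2"
      by (rule d) (use YR[OF rp] YR[OF qp] Yd mesh \<open>j \<in> I\<close> in \<open>auto intro: order_trans\<close>)
    show "\<bar>Y q j - Y r j\<bar> \<le> e / 2" using Yd[OF \<open>j \<in> I\<close>] mesh by linarith
  qed
  have low: "\<Phi> (Y r) (b i) \<ge> Y r (b i)" if "label r i = 0" "i < n" "\<forall>i<n. r i \<le> p" for r i
  proof (cases "r i = 0")
    case True
    then have "Y r (b i) = - R" using that by (simp add: Y_def cb)
    moreover have "\<bar>\<Phi> (Y r) (b i)\<bar> \<le> R" by (intro bound) (use YR that bI in auto)
    ultimately show ?thesis by linarith
  qed (use that in \<open>auto simp: label_def split: if_splits\<close>)
  have high: "\<Phi> (Y r) (b i) \<le> Y r (b i)" if "label r i \<noteq> 0" for r i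
    using that by (auto simp: label_def split: if_splits)
  \<comment> \<open>The vertex labelled 0 gives the lower bound, the one labelled 1 the upper bound;
    passing to \<open>q\<close> costs \<open>e / 2\<close> for \<open>\<Phi>\<close> and
    \<open>e / 2\<close> for the coordinate itself.\<close>
  have main: "\<bar>\<Phi> (Y q) (b i) - Y q (b i)\<bar> \<le> e" if i: "i < n" for i
  proof -
    obtain r s where rs: "\<forall>j<n. q j \<le> r j \<and> r j \<le> q j + 1" "\<forall>j<n. q j \<le> s j \<and> s j \<le> q j + 1"
      "label r i = 0" "label s i \<noteq> 0"
      using rs i by (metis (no_types, lifting) label_def)
    have "\<forall>i<n. r i \<le> p" by (rule close(3)[OF rs(1) bI[OF i]])
    from close(1,2)[OF rs(1) bI[OF i]] close(1,2)[OF rs(2) bI[OF i]] low[OF rs(3) i this] high[OF rs(4)]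
    show ?thesis by linarith
  qed
  show ?thesis
  proof
    show "\<forall>i\<in>I. \<bar>Y q i\<bar> \<le> R" using YR q by (auto intro: less_imp_le)
    show "\<forall>i\<in>I. \<bar>\<Phi> (Y q) i - Y q i\<bar> \<le> e" using main c by metis
  qed
qed

text \<open>The idea is to compose \<open>A\<close> with the interpolation (by a partition of unity) of the values on a
  finite net of \<open>S\<close>, which leaves a finite-dimensional problem. Equicontinuity makes the resulting
  approximate fixed points precompact.\<close>

lemma schauder_equicontinuous:
  fixes S :: "'b::euclidean_space set" and A :: "('b \<Rightarrow> 'a::euclidean_space) \<Rightarrow> 'b \<Rightarrow> 'a"
  assumes "compact S" and "0 < R"
    and B_def: "B = {x. continuous_on S x \<and> (\<forall>s\<in>S. \<forall>i\<in>Basis. \<bar>x s \<bullet> i\<bar> \<le> R)}"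
    and maps: "\<And>x. x \<in> B \<Longrightarrow> A x \<in> B"
    and equi: "\<And>\<epsilon>. 0 < \<epsilon> \<Longrightarrow>
      \<exists>\<delta>>0. \<forall>x\<in>B. \<forall>s\<in>S. \<forall>t\<in>S. dist s t < \<delta> \<longrightarrow> norm (A x s - A x t) < \<epsilon>"
    and unif: "\<And>\<epsilon>. 0 < \<epsilon> \<Longrightarrow>
      \<exists>\<delta>>0. \<forall>x\<in>B. \<forall>y\<in>B. (\<forall>s\<in>S. norm (x s - y s) \<le> \<delta>) \<longrightarrow> (\<forall>s\<in>S. norm (A x s - A y s) \<le> \<epsilon>)"
  obtains x where "x \<in> B" and "\<And>s. s \<in> S \<Longrightarrow> A x s = x s"
proof -
  have approx: "\<exists>x\<in>B. \<forall>s\<in>S. norm (A x s - x s) \<le> e" if "0 < e" for e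
  proof -
    \<comment> \<open>The error at a net point is at most \<open>e'\<close> per coordinate, hence
      \<open>DIM('a) * e'\<close> in norm; one more \<open>e'\<close> is spent on moving to a
      neighbouring point of \<open>S\<close>.\<close>
    define e' where "e' = e / (1 + DIM('a))"
    have "0 < e'" using that by (simp add: e'_def)
    have e': "real DIM('a) * e' + e' = e"
    proof -
      have "1 + real DIM('a) \<noteq> 0" by linarith
      then have "(1 + real DIM('a)) * e' = e" by (simp add: e'_def)
      then show ?thesis by (simp add: distrib_right)
    qed
    obtain h where "0 < h"
      and h: "\<And>x s t. x \<in> B \<Longrightarrow> s \<in> S \<Longrightarrow> t \<in> S \<Longrightarrow> dist s t < h \<Longrightarrow> norm (A x s - A x t) < e'"
      using equi[OF \<open>0 < e'\<close>] by metis
    obtain N where "finite N" "N \<subseteq> S" and N: "S \<subseteq> (\<Union>p\<in>N. ball p h)"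
    proof (rule compactE_image[OF \<open>compact S\<close>, of S "\<lambda>p. ball p h"])
      show "S \<subseteq> (\<Union>p\<in>S. ball p h)" using \<open>0 < h\<close> by auto
    qed auto
    \<comment> \<open>The hat functions \<open>w p\<close> vanish outside the balls of radius
      \<open>h\<close>; division by their sum \<open>W\<close>, positive on \<open>S\<close> because
      \<open>N\<close> is an \<open>h\<close>-net, makes them a partition of unity.\<close>
    define w where "w p s = max 0 (h - dist p s)" for p s :: 'b
    define W where "W s = (\<Sum>p\<in>N. w p s)" for s
    have w_nonneg: "0 \<le> w p s" for p s by (simp add: w_def)
    have W_pos: "0 < W s" if s: "s \<in> S" for s
    proof -
      obtain p where "p \<in> N" "dist p s < h" using N s by auto
      then have "0 < w p s" by (simp add: w_def)
      then show ?thesis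
        unfolding W_def using \<open>finite N\<close> \<open>p \<in> N\<close> w_nonneg by (meson sum_pos2)
    qed
    \<comment> \<open>A table \<open>y\<close> of coordinates at the net points becomes a continuous
      function; the finite-dimensional map sends \<open>y\<close> to the table of
      \<open>A (interp y)\<close>.\<close>
    define interp :: "('b \<times> 'a \<Rightarrow> real) \<Rightarrow> 'b \<Rightarrow> 'a" where
      "interp y s = (\<Sum>p\<in>N. (w p s / W s) *\<^sub>R (\<Sum>i\<in>Basis. y (p, i) *\<^sub>R i))" for y s
    have weights: "(\<Sum>p\<in>N. w p s / W s) = 1" if "s \<in> S" for s
      using W_pos[OF that] by (simp add: W_def flip: sum_divide_distrib)
    have interp_coord: "interp y s \<bullet> i = (\<Sum>p\<in>N. (w p s / W s) * y (p, i))" if "i \<in> Basis" for y s i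
      unfolding interp_def by (subst inner_sum_left) (simp add: that)
    have interp_B: "interp y \<in> B" if y: "\<forall>j\<in>N \<times> Basis. \<bar>y j\<bar> \<le> R" for y
    proof -
      have "continuous_on S (interp y)"
        unfolding interp_def w_def W_def
        by (intro continuous_intros) (use W_pos in \<open>force simp: W_def w_def\<close>)
      moreover have "\<bar>interp y s \<bullet> i\<bar> \<le> R" if "s \<in> S" "i \<in> Basis" for s i
      proof -
        have "\<bar>interp y s \<bullet> i\<bar> \<le> (\<Sum>p\<in>N. (w p s / W s) * R)"
          unfolding interp_coord[OF \<open>i \<in> Basis\<close>]
          by (rule order_trans[OF sum_abs sum_mono])
             (use y that w_nonneg W_pos[OF \<open>s \<in> S\<close>] in \<open>auto simp: abs_mult intro!: mult_left_mono divide_right_mono\<close>)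
        also have "\<dots> = R" using weights[OF \<open>s \<in> S\<close>] by (metis sum_distrib_right mult_1)
        finally show ?thesis .
      qed
      ultimately show ?thesis by (simp add: B_def)
    qed
    \<comment> \<open>The value at \<open>s\<close> is a convex combination of the entries at net
      points closer than \<open>h\<close>, so a common bound on their distances to \<open>z\<close>
      is inherited.\<close>
    have interp_close: "norm (interp y s - z) \<le> c"
      if "s \<in> S" and c: "\<And>p. p \<in> N \<Longrightarrow> dist p s < h \<Longrightarrow> norm ((\<Sum>i\<in>Basis. y (p, i) *\<^sub>R i) - z) \<le> c"
      for y s z c
    proof -
      have "z = (\<Sum>p\<in>N. (w p s / W s) *\<^sub>R z)"
        using weights[OF \<open>s \<in> S\<close>] by (simp flip: scaleR_sum_left)
      then have "interp y s - z = (\<Sum>p\<in>N. (w p s / W s) *\<^sub>R ((\<Sum>i\<in>Basis. y (p, i) *\<^sub>R i) - z))"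
        by (simp add: interp_def scaleR_diff_right sum_subtractf)
      also have "norm \<dots> \<le> (\<Sum>p\<in>N. (w p s / W s) * c)"
      proof (rule order_trans[OF norm_sum sum_mono])
        fix p assume "p \<in> N"
        show "norm ((w p s / W s) *\<^sub>R ((\<Sum>i\<in>Basis. y (p, i) *\<^sub>R i) - z)) \<le> w p s / W s * c"
        proof (cases "dist p s < h")
          case True
          then show ?thesis
            using c[OF \<open>p \<in> N\<close>] w_nonneg[of p s] W_pos[OF \<open>s \<in> S\<close>]
            by (auto intro!: mult_left_mono divide_right_mono)
        qed (simp add: w_def)
      qed
      also have "\<dots> = c" using weights[OF \<open>s \<in> S\<close>] by (metis sum_distrib_right mult_1)
      finally show ?thesis .
    qed
    obtain y where yR: "\<forall>j\<in>N \<times> Basis. \<bar>y j\<bar> \<le> R"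
      and y: "\<forall>j\<in>N \<times> Basis. \<bar>A (interp y) (fst j) \<bullet> snd j - y j\<bar> \<le> e'"
    proof (rule approximate_fixed_point_finite[of "N \<times> Basis" R e'
            "\<lambda>y j. A (interp y) (fst j) \<bullet> snd j"])
      show "finite (N \<times> (Basis :: 'a set))" using \<open>finite N\<close> by simp
      show "\<bar>A (interp y) (fst i) \<bullet> snd i\<bar> \<le> R" if "\<forall>j\<in>N \<times> Basis. \<bar>y j\<bar> \<le> R" "i \<in> N \<times> Basis" for y i
        using maps[OF interp_B[OF that(1)]] that(2) \<open>N \<subseteq> S\<close> by (auto simp: B_def)
      fix \<epsilon> :: real assume "0 < \<epsilon>"
      then obtain d where "0 < d" and d: "\<And>x y s. x \<in> B \<Longrightarrow> y \<in> B \<Longrightarrow> (\<forall>s\<in>S. norm (x s - y s) \<le> d)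
          \<Longrightarrow> s \<in> S \<Longrightarrow> norm (A x s - A y s) \<le> \<epsilon>"
        using unif by metis
      show "\<exists>\<delta>>0. \<forall>y z. (\<forall>j\<in>N \<times> Basis. \<bar>y j\<bar> \<le> R \<and> \<bar>z j\<bar> \<le> R \<and> \<bar>y j - z j\<bar> \<le> \<delta>) \<longrightarrow>
          (\<forall>i\<in>N \<times> Basis. \<bar>A (interp y) (fst i) \<bullet> snd i - A (interp z) (fst i) \<bullet> snd i\<bar> \<le> \<epsilon>)"
      proof (intro exI conjI allI impI ballI)
        show "0 < d / DIM('a)" using \<open>0 < d\<close> by simp
        fix y z :: "'b \<times> 'a \<Rightarrow> real" and i :: "'b \<times> 'a"
        assume yz: "\<forall>j\<in>N \<times> Basis. \<bar>y j\<bar> \<le> R \<and> \<bar>z j\<bar> \<le> R \<and> \<bar>y j - z j\<bar> \<le> d / DIM('a)"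
          and i: "i \<in> N \<times> Basis"
        have "norm (interp y s - interp z s) \<le> d" if "s \<in> S" for s
        proof -
          have "interp y s - interp z s = interp (\<lambda>j. y j - z j) s - 0"
            by (simp add: interp_def algebra_simps sum_subtractf)
          also have "norm \<dots> \<le> d"
          proof (rule interp_close[OF \<open>s \<in> S\<close>])
            fix p assume "p \<in> N"
            have "norm (\<Sum>i\<in>Basis. (y (p, i) - z (p, i)) *\<^sub>R (i :: 'a)) \<le> (\<Sum>i\<in>(Basis :: 'a set). d / DIM('a))"
              by (rule order_trans[OF norm_sum sum_mono]) (use yz \<open>p \<in> N\<close> in auto)
            then show "norm ((\<Sum>i\<in>Basis. (y (p, i) - z (p, i)) *\<^sub>R (i :: 'a)) - 0) \<le> d"
              by simp
          qed
          finally show ?thesis .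
        qed
        then have "norm (A (interp y) (fst i) - A (interp z) (fst i)) \<le> \<epsilon>"
          using yz i \<open>N \<subseteq> S\<close> by (intro d interp_B) auto
        then show "\<bar>A (interp y) (fst i) \<bullet> snd i - A (interp z) (fst i) \<bullet> snd i\<bar> \<le> \<epsilon>"
          using i by (metis Basis_le_norm inner_diff_left mem_Sigma_iff order_trans prod.collapse)
      qed
    qed (use \<open>0 < R\<close> \<open>0 < e'\<close> in auto)
    \<comment> \<open>\<open>interp_close\<close> is used with \<open>z = A (interp y) s\<close>:
      the entries at nearby net points almost equal the values of \<open>A (interp y)\<close> there,
      and these are within \<open>e'\<close> of the value at \<open>s\<close>.\<close>
    have "norm (A (interp y) s - interp y s) \<le> e" if "s \<in> S" for s
      unfolding norm_minus_commute[of _ "interp y s"]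
    proof (rule interp_close[OF \<open>s \<in> S\<close>])
      fix p assume p: "p \<in> N" "dist p s < h"
      have "(\<Sum>i\<in>Basis. y (p, i) *\<^sub>R i) - A (interp y) p
          = (\<Sum>i\<in>Basis. (y (p, i) - A (interp y) p \<bullet> i) *\<^sub>R i)"
        by (simp add: algebra_simps sum_subtractf euclidean_representation)
      also have "norm \<dots> \<le> (\<Sum>i\<in>(Basis :: 'a set). e')"
        by (rule order_trans[OF norm_sum sum_mono]) (use y \<open>p \<in> N\<close> in \<open>force simp: abs_minus_commute\<close>)
      finally have "norm ((\<Sum>i\<in>Basis. y (p, i) *\<^sub>R i) - A (interp y) p) \<le> DIM('a) * e'" by simp
      moreover have "norm (A (interp y) p - A (interp y) s) < e'"
        using p \<open>N \<subseteq> S\<close> \<open>s \<in> S\<close> by (intro h interp_B yR) auto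
      ultimately have "norm (((\<Sum>i\<in>Basis. y (p, i) *\<^sub>R i) - A (interp y) p) + (A (interp y) p - A (interp y) s))
          \<le> DIM('a) * e' + e'"
        by (intro norm_triangle_mono) auto
      then show "norm ((\<Sum>i\<in>Basis. y (p, i) *\<^sub>R i) - A (interp y) s) \<le> e"
        by (simp add: e')
    qed
    with interp_B[OF yR] show ?thesis by blast
  qed
  then have "\<forall>n. \<exists>x\<in>B. \<forall>s\<in>S. norm (A x s - x s) \<le> 1 / real (Suc n)" by simp
  then obtain x where xB: "\<And>n. x n \<in> B"
    and x: "\<And>n s. s \<in> S \<Longrightarrow> norm (A (x n) s - x n s) \<le> 1 / real (Suc n)"
    by metis
  have "norm (A (x n) s) \<le> DIM('a) * R" if "s \<in> S" for n s
  proof -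
    have "norm (A (x n) s) \<le> (\<Sum>i\<in>(Basis :: 'a set). R)"
      by (rule order_trans[OF norm_le_l1 sum_mono]) (use maps[OF xB] that in \<open>auto simp: B_def\<close>)
    then show ?thesis by simp
  qed
  moreover have "\<exists>d. 0 < d \<and> (\<forall>n t. t \<in> S \<and> norm (s - t) < d \<longrightarrow> norm (A (x n) s - A (x n) t) < e)"
    if "s \<in> S" "0 < e" for s e
    using equi[OF \<open>0 < e\<close>] xB \<open>s \<in> S\<close> by (metis dist_norm)
  \<comment> \<open>Arzela-Ascoli is applied to the images \<open>A (x n)\<close>, since elements of
    \<open>B\<close> need not be equicontinuous; the functions \<open>x (k n)\<close> follow because
    they are ever closer to their images.\<close>
  ultimately obtain g k where "continuous_on S g" "strict_mono (k :: nat \<Rightarrow> nat)"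
    and lim: "\<And>e. 0 < e \<Longrightarrow> \<exists>N. \<forall>n s. n \<ge> N \<and> s \<in> S \<longrightarrow> norm (A (x (k n)) s - g s) < e"
    by (rule Arzela_Ascoli[OF \<open>compact S\<close>, of "\<lambda>n. A (x n)"]) auto
  have close: "\<exists>n. \<forall>s\<in>S. norm (A (x n) s - g s) \<le> e \<and> norm (x n s - g s) \<le> e" if "0 < e" for e
  proof -
    obtain n1 where n1: "\<And>n s. n \<ge> n1 \<Longrightarrow> s \<in> S \<Longrightarrow> norm (A (x (k n)) s - g s) < e / 2"
      using lim[of "e / 2"] \<open>0 < e\<close> by auto
    obtain n2 where n2: "1 / real (Suc n2) < e / 2"
      using \<open>0 < e\<close> nat_approx_posE[of "e / 2"] by auto
    define n where "n = max n1 n2"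
    have "n2 \<le> k n" using seq_suble[OF \<open>strict_mono k\<close>, of n] by (simp add: n_def)
    then have "1 / real (Suc (k n)) \<le> 1 / real (Suc n2)" by (simp add: frac_le)
    with n2 x have *: "norm (A (x (k n)) s - x (k n) s) \<le> e / 2" if "s \<in> S" for s
      using that by (meson less_imp_le order_trans)
    have "norm (A (x (k n)) s - g s) < e / 2" if "s \<in> S" for s
      using n1[of n s] that by (simp add: n_def)
    moreover have "norm (x (k n) s - g s) \<le> e" if "s \<in> S" for s
    proof -
      have "dist (x (k n) s) (g s) \<le> e / 2 + e / 2"
        using *[OF that] calculation[OF that]
        by (intro dist_triangle_le[of _ "A (x (k n)) s"]) (simp add: dist_norm norm_minus_commute)
      then show ?thesis by (simp add: dist_norm)
    qed
    ultimately have "\<forall>s\<in>S. norm (A (x (k n)) s - g s) \<le> e \<and> norm (x (k n) s - g s) \<le> e"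
      using \<open>0 < e\<close> by fastforce
    then show ?thesis by blast
  qed
  have "g \<in> B"
  proof -
    have "\<bar>g s \<bullet> i\<bar> \<le> R" if "s \<in> S" "i \<in> Basis" for s i
    proof (rule field_le_epsilon)
      fix e :: real assume "0 < e"
      then obtain n where "norm (x n s - g s) \<le> e" using close \<open>s \<in> S\<close> by blast
      then have "\<bar>(x n s - g s) \<bullet> i\<bar> \<le> e" by (rule order_trans[OF Basis_le_norm[OF \<open>i \<in> Basis\<close>]])
      moreover have "\<bar>x n s \<bullet> i\<bar> \<le> R" using xB that by (auto simp: B_def)
      ultimately show "\<bar>g s \<bullet> i\<bar> \<le> R + e" by (simp add: inner_diff_left)
    qed
    then show ?thesis using \<open>continuous_on S g\<close> by (simp add: B_def)
  qed
  moreover have "A g s = g s" if "s \<in> S" for s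
  proof -
    \<comment> \<open>Uniform continuity of \<open>A\<close> on \<open>B\<close> makes
      \<open>A (x n)\<close> close to \<open>A g\<close>, while \<open>A (x n)\<close> is also close
      to \<open>g\<close>.\<close>
    have "norm (A g s - g s) \<le> 0 + e" if "0 < e" for e
    proof -
      obtain d where "0 < d" and d: "\<And>x y s. x \<in> B \<Longrightarrow> y \<in> B \<Longrightarrow> (\<forall>s\<in>S. norm (x s - y s) \<le> d)
          \<Longrightarrow> s \<in> S \<Longrightarrow> norm (A x s - A y s) \<le> e / 2"
        using unif[of "e / 2"] \<open>0 < e\<close> by (metis half_gt_zero)
      obtain n where n: "\<forall>s\<in>S. norm (A (x n) s - g s) \<le> min d (e / 2) \<and> norm (x n s - g s) \<le> min d (e / 2)"
        using close[of "min d (e / 2)"] \<open>0 < d\<close> \<open>0 < e\<close> by auto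
      then have "norm (A (x n) s - A g s) \<le> e / 2"
        using xB \<open>g \<in> B\<close> \<open>s \<in> S\<close> by (intro d) auto
      moreover have "norm (A (x n) s - g s) \<le> e / 2" using n \<open>s \<in> S\<close> by auto
      ultimately have "dist (A g s) (g s) \<le> e / 2 + e / 2"
        by (metis dist_norm dist_commute dist_triangle_le add_mono)
      then show ?thesis by (simp add: dist_norm)
    qed
    then have "norm (A g s - g s) \<le> 0" by (rule field_le_epsilon)
    then show ?thesis by simp
  qed
  ultimately show ?thesis using that by blast
qed

section \<open>An integral equation with a monotone argument deviation\<close>

text \<open>A monotone \<open>\<tau>\<close> may have jumps but is Borel measurable; hence the
  composition is measurable, and it is bounded because \<open>h\<close> is continuous on the compact
  \<open>K\<close>.\<close>

lemma integrable_continuous_comp_mono: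
  fixes h :: "real \<Rightarrow> 'a::euclidean_space" and \<tau> :: "real \<Rightarrow> real"
  assumes "compact K" "mono \<tau>" "\<And>s. \<tau> s \<in> K" "continuous_on K h"
  shows "(\<lambda>s. h (\<tau> s)) integrable_on {c..d}"
proof -
  have "bounded (h ` K)"
    by (intro compact_imp_bounded compact_continuous_image assms)
  then obtain C where C: "\<And>u. u \<in> K \<Longrightarrow> norm (h u) \<le> C"
    unfolding bounded_iff by blast
  have "\<tau> \<in> borel \<rightarrow>\<^sub>M restrict_space borel K"
    using borel_measurable_mono[OF assms(2)] assms(3) by (intro measurable_restrict_space2) auto
  then have "(\<lambda>s. h (\<tau> s)) \<in> borel_measurable borel"
    using borel_measurable_continuous_on_restrict[OF assms(4)] by (rule measurable_compose)
  then have "(\<lambda>s. h (\<tau> s)) \<in> borel_measurable (lebesgue_on {c..d})"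
    by (intro measurable_restrict_space1 measurable_completion) simp
  then show ?thesis
  proof (rule measurable_bounded_by_integrable_imp_integrable[where g = "\<lambda>_. C"])
    show "norm (h (\<tau> s)) \<le> C" for s using C assms(3) by blast
  qed auto
qed

lemma integral_minus_const_bound:
  fixes f :: "real \<Rightarrow> 'a::euclidean_space"
  assumes "f integrable_on {c..d}" "c \<le> d" "\<And>u. u \<in> {c..d} \<Longrightarrow> norm (f u - D) \<le> e"
  shows "norm (integral {c..d} f - (d - c) *\<^sub>R D) \<le> e * (d - c)"
proof -
  have "((\<lambda>u. f u - D) has_integral (integral {c..d} f - (d - c) *\<^sub>R D)) {c..d}"
    using has_integral_diff[OF integrable_integral[OF assms(1)] has_integral_const_real[of D c d]] assms(2)
    by simp
  moreover have "0 \<le> e" using order_trans[OF norm_ge_zero assms(3)[of c]] assms(2) by simp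
  ultimately have "norm (integral {c..d} f - (d - c) *\<^sub>R D) \<le> e * measure lborel {c..d}"
    by (intro has_integral_bound_real[where f = "\<lambda>u. f u - D" and S = "{}"] assms) auto
  then show ?thesis using assms(2) by simp
qed

text \<open>The right-hand side is read as an operator on functions over \<open>{a..b}\<close>.
  Since \<open>F\<close> and \<open>P\<close> are bounded, its images are bounded and share the
  Lipschitz constant \<open>C\<close>, so \<open>schauder_equicontinuous\<close> applies. The end
  value \<open>x b\<close> enters the operator, which builds in the boundary condition.\<close>

lemma periodic_integral_equation:
  fixes F :: "real \<Rightarrow> 'a::euclidean_space \<Rightarrow> 'a" and \<tau> :: "real \<Rightarrow> real"
  assumes "a \<le> b" and "compact K" and "K \<subseteq> {a..b}" and "mono \<tau>" and \<tau>: "\<And>s. \<tau> s \<in> K"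
    and F: "continuous_on (K \<times> UNIV) (\<lambda>(t, x). F t x)"
    and C: "\<And>t x. t \<in> K \<Longrightarrow> norm (F t x) \<le> C"
    and P: "continuous_on UNIV P" and D: "\<And>z. norm (P z) \<le> D"
  obtains x where "continuous_on {a..b} x"
    and "\<And>r. r \<in> {a..b} \<Longrightarrow> x r = P (x b) + integral {a..r} (\<lambda>s. F (\<tau> s) (x (\<tau> s)))"
proof -
  \<comment> \<open>\<open>D\<close> bounds the initial value and \<open>C * (b - a)\<close> the
    integral; the added 1 keeps \<open>R\<close> positive if both vanish.\<close>
  define R where "R = D + C * (b - a) + 1"
  have "0 \<le> C" using C[OF \<tau>] norm_ge_zero order_trans by blast
  have "0 \<le> D" using D norm_ge_zero order_trans by blast
  have "0 < R" using \<open>0 \<le> C\<close> \<open>0 \<le> D\<close> \<open>a \<le> b\<close> by (simp add: R_def add_nonneg_pos)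
  define B where "B = {x. continuous_on {a..b} x \<and> (\<forall>s\<in>{a..b}. \<forall>i\<in>Basis. \<bar>x s \<bullet> (i :: 'a)\<bar> \<le> R)}"
  define A where "A x r = P (x b) + integral {a..r} (\<lambda>s. F (\<tau> s) (x (\<tau> s)))" for x r
  \<comment> \<open>All functions in \<open>B\<close> take values in the compact box
    \<open>Q\<close>, which gives uniform continuity of \<open>F\<close> on
    \<open>K \<times> Q\<close> and of \<open>P\<close> on \<open>Q\<close>.\<close>
  define Q where "Q = cbox (- (\<Sum>i\<in>Basis. R *\<^sub>R i)) (\<Sum>i\<in>Basis. R *\<^sub>R i :: 'a)"
  have "compact Q" by (simp add: Q_def)
  have Q: "x s \<in> Q" if "x \<in> B" "s \<in> {a..b}" for x s
    using that by (auto simp: Q_def mem_box B_def abs_le_iff minus_le_iff)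
  have int: "(\<lambda>s. F (\<tau> s) (x (\<tau> s))) integrable_on {c..d}" if "x \<in> B" for x c d
  proof (rule integrable_continuous_comp_mono[OF \<open>compact K\<close> \<open>mono \<tau>\<close> \<tau>])
    have "continuous_on K (\<lambda>u. (u, x u))"
      using that \<open>K \<subseteq> {a..b}\<close>
      by (intro continuous_on_Pair continuous_on_id) (auto simp: B_def intro: continuous_on_subset)
    then show "continuous_on K (\<lambda>u. F u (x u))"
      using continuous_on_compose2[OF F, of K "\<lambda>u. (u, x u)"] by auto
  qed
  have incr: "norm (A x t - A x s) \<le> C * (t - s)" if "x \<in> B" "a \<le> s" "s \<le> t" for x s t
  proof -
    have "A x t - A x s = integral {s..t} (\<lambda>s. F (\<tau> s) (x (\<tau> s)))"
      using Henstock_Kurzweil_Integration.integral_combine[OF that(2,3) int[OF that(1)]]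
      by (simp add: A_def algebra_simps)
    also have "norm \<dots> \<le> C * (t - s)"
      using integral_minus_const_bound[OF int[OF that(1)] that(3), of 0 C] C \<tau> by simp
    finally show ?thesis .
  qed
  have norm_A: "norm (A x r) \<le> R" if "x \<in> B" "r \<in> {a..b}" for x r
  proof -
    have "norm (A x r - A x a) \<le> C * (r - a)" using incr[OF that(1)] that(2) by simp
    also have "\<dots> \<le> C * (b - a)" using that(2) \<open>0 \<le> C\<close> by (intro mult_left_mono) auto
    finally have "norm (A x r - A x a) \<le> C * (b - a)" .
    moreover have "norm (A x a) \<le> D" using D by (simp add: A_def)
    ultimately show ?thesis using norm_triangle_sub[of "A x r" "A x a"] by (simp add: R_def)
  qed
  have lip: "norm (A x s - A x t) \<le> C * dist s t" if "x \<in> B" "s \<in> {a..b}" "t \<in> {a..b}" for x s t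
    using incr[OF that(1), of s t] incr[OF that(1), of t s] that
    by (cases "s \<le> t") (auto simp: dist_real_def norm_minus_commute)
  show ?thesis
  proof (rule schauder_equicontinuous[OF compact_Icc \<open>0 < R\<close> B_def, of A])
    show "A x \<in> B" if "x \<in> B" for x
    proof -
      have "C-lipschitz_on {a..b} (A x)"
        using lip[OF that] \<open>0 \<le> C\<close> by (auto simp: lipschitz_on_def dist_norm)
      then have "continuous_on {a..b} (A x)" by (rule lipschitz_on_continuous_on)
      then show ?thesis
        using norm_A[OF that] by (auto simp: B_def intro: order_trans[OF Basis_le_norm])
    qed
  next
    fix e :: real assume "0 < e"
    \<comment> \<open>\<open>C + 1\<close> replaces the Lipschitz constant to allow
      \<open>C = 0\<close>.\<close>
    have "norm (A x s - A x t) < e"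
      if "x \<in> B" "s \<in> {a..b}" "t \<in> {a..b}" "dist s t < e / (C + 1)" for x s t
    proof -
      have "norm (A x s - A x t) \<le> (C + 1) * dist s t"
        using lip[OF that(1-3)] by (simp add: distrib_right add_increasing2)
      also have "\<dots> < e" using that(4) \<open>0 \<le> C\<close> by (simp add: field_simps)
      finally show ?thesis .
    qed
    then show "\<exists>d>0. \<forall>x\<in>B. \<forall>s\<in>{a..b}. \<forall>t\<in>{a..b}. dist s t < d \<longrightarrow> norm (A x s - A x t) < e"
      using \<open>0 < e\<close> \<open>0 \<le> C\<close> by (intro exI[of _ "e / (C + 1)"]) auto
  next
    fix e :: real assume "0 < e"
    \<comment> \<open>Half of \<open>e\<close> is reserved for the change of the integral and half
      for that of \<open>P (x b)\<close>; the summand 1 covers \<open>a = b\<close>.\<close>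
    define h where "h = e / (2 * (b - a + 1))"
    have "0 < h" using \<open>0 < e\<close> \<open>a \<le> b\<close> by (simp add: h_def)
    have h: "h * (b - a) \<le> e / 2"
      using \<open>0 < e\<close> \<open>a \<le> b\<close> by (simp add: h_def divide_simps)
    have "uniformly_continuous_on (K \<times> Q) (\<lambda>(t, x). F t x)"
      by (intro compact_uniformly_continuous compact_Times \<open>compact K\<close> \<open>compact Q\<close>
          continuous_on_subset[OF F]) auto
    then obtain d1 where "0 < d1"
      and d1: "\<forall>p\<in>K \<times> Q. \<forall>q\<in>K \<times> Q. dist q p < d1
        \<longrightarrow> dist ((\<lambda>(t, x). F t x) q) ((\<lambda>(t, x). F t x) p) < h"
      using \<open>0 < h\<close> unfolding uniformly_continuous_on_def by blast
    have d1: "norm (F t x - F t y) < h" if "t \<in> K" "x \<in> Q" "y \<in> Q" "norm (x - y) < d1" for t x y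
      using bspec[OF bspec[OF d1, of "(t, y)"], of "(t, x)"] that by (simp add: dist_Pair_Pair dist_norm)
    have "uniformly_continuous_on Q P"
      by (intro compact_uniformly_continuous \<open>compact Q\<close> continuous_on_subset[OF P]) auto
    then obtain d2 where "0 < d2"
      and d2: "\<forall>z\<in>Q. \<forall>y\<in>Q. norm (y - z) < d2 \<longrightarrow> norm (P y - P z) < e / 2"
      using half_gt_zero[OF \<open>0 < e\<close>] unfolding uniformly_continuous_on_def dist_norm by blast
    have d2: "norm (P y - P z) < e / 2" if "y \<in> Q" "z \<in> Q" "norm (y - z) < d2" for y z
      using d2 that by blast
    \<comment> \<open>The halving turns the non-strict hypothesis \<open>\<le> d\<close> into strict
      bounds by \<open>d1\<close> and \<open>d2\<close>.\<close>
    define d where "d = min d1 d2 / 2"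
    have "0 < d" "d < d1" "d < d2" using \<open>0 < d1\<close> \<open>0 < d2\<close> by (auto simp: d_def)
    have "norm (A x r - A y r) \<le> e"
      if x: "x \<in> B" and y: "y \<in> B" and xy: "\<forall>s\<in>{a..b}. norm (x s - y s) \<le> d" and r: "r \<in> {a..b}" for x y r
    proof -
      have "norm (F (\<tau> s) (x (\<tau> s)) - F (\<tau> s) (y (\<tau> s))) \<le> h" for s
      proof -
        have "\<tau> s \<in> {a..b}" using \<tau> \<open>K \<subseteq> {a..b}\<close> by blast
        then show ?thesis
          using xy \<open>d < d1\<close> by (intro less_imp_le d1 \<tau> Q x y) (auto intro: le_less_trans)
      qed
      then have "norm (integral {a..r} (\<lambda>s. F (\<tau> s) (x (\<tau> s)) - F (\<tau> s) (y (\<tau> s)))) \<le> h * (r - a)"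
        using integral_minus_const_bound[OF integrable_diff[OF int[OF x] int[OF y]], of a r 0 h] r by simp
      also have "\<dots> \<le> h * (b - a)" using r \<open>0 < h\<close> by simp
      finally have "norm (integral {a..r} (\<lambda>s. F (\<tau> s) (x (\<tau> s)) - F (\<tau> s) (y (\<tau> s)))) \<le> e / 2"
        using h by linarith
      moreover have "norm (P (x b) - P (y b)) \<le> e / 2"
        using xy \<open>a \<le> b\<close> \<open>d < d2\<close> by (intro less_imp_le d2 Q x y) (auto intro: le_less_trans)
      moreover have "A x r - A y r = (P (x b) - P (y b))
          + integral {a..r} (\<lambda>s. F (\<tau> s) (x (\<tau> s)) - F (\<tau> s) (y (\<tau> s)))"
        by (simp add: A_def Henstock_Kurzweil_Integration.integral_diff[OF int[OF x] int[OF y]])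
      ultimately show ?thesis using norm_triangle_mono[of _ "e / 2" _ "e / 2"] by simp
    qed
    then show "\<exists>d>0. \<forall>x\<in>B. \<forall>y\<in>B. (\<forall>s\<in>{a..b}. norm (x s - y s) \<le> d) \<longrightarrow>
        (\<forall>s\<in>{a..b}. norm (A x s - A y s) \<le> e)"
      using \<open>0 < d\<close> by blast
  next
    fix x assume "x \<in> B" and fixed: "\<And>s. s \<in> {a..b} \<Longrightarrow> A x s = x s"
    show thesis
    proof (rule that)
      show "continuous_on {a..b} x" using \<open>x \<in> B\<close> by (simp add: B_def)
      show "x r = P (x b) + integral {a..r} (\<lambda>s. F (\<tau> s) (x (\<tau> s)))" if "r \<in> {a..b}" for r
        using fixed[OF that] unfolding A_def by (rule sym)
    qed
  qed
qed

section \<open>Nabla derivatives\<close>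

lemma has_nabla_derivative_iff:
  assumes "t \<in> T"
  shows "has_nabla_derivative T h D t \<longleftrightarrow>
    (\<forall>\<epsilon>>0. \<exists>\<delta>>0. \<forall>s\<in>T. \<bar>s - t\<bar> < \<delta> \<longrightarrow>
      norm (h (backward_jump T t) - h s - (backward_jump T t - s) *\<^sub>R D) \<le> \<epsilon> * \<bar>backward_jump T t - s\<bar>)"
    (is "?L \<longleftrightarrow> (\<forall>\<epsilon>>0. \<exists>\<delta>>0. \<forall>s\<in>T. _ \<longrightarrow> ?P \<epsilon> s)")
proof (intro iffI allI impI)
  fix \<epsilon> :: real assume "?L" "0 < \<epsilon>"
  then obtain U where "openin (top_of_set T) U" "t \<in> U" "\<forall>s\<in>U. ?P \<epsilon> s"
    unfolding has_nabla_derivative_def by blast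
  then show "\<exists>\<delta>>0. \<forall>s\<in>T. \<bar>s - t\<bar> < \<delta> \<longrightarrow> ?P \<epsilon> s"
    unfolding openin_euclidean_subtopology_iff dist_real_def by blast
next
  assume R: "\<forall>\<epsilon>>0. \<exists>\<delta>>0. \<forall>s\<in>T. \<bar>s - t\<bar> < \<delta> \<longrightarrow> ?P \<epsilon> s"
  show ?L
    unfolding has_nabla_derivative_def
  proof (intro allI impI)
    fix \<epsilon> :: real assume "0 < \<epsilon>"
    then obtain \<delta> where "0 < \<delta>" and \<delta>: "\<forall>s\<in>T. \<bar>s - t\<bar> < \<delta> \<longrightarrow> ?P \<epsilon> s" using R by blast
    have "openin (top_of_set T) (T \<inter> ball t \<delta>)" by (simp add: openin_open_Int)
    moreover have "t \<in> T \<inter> ball t \<delta>" using assms \<open>0 < \<delta>\<close> by simp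
    moreover have "\<forall>s\<in>T \<inter> ball t \<delta>. ?P \<epsilon> s"
      using \<delta> by (auto simp: dist_real_def abs_minus_commute)
    ultimately show "\<exists>U. openin (top_of_set T) U \<and> t \<in> U \<and> (\<forall>s\<in>U. ?P \<epsilon> s)" by blast
  qed
qed

lemma has_nabla_derivative_diff:
  assumes "t \<in> T" and h: "has_nabla_derivative T h D t" and g: "has_nabla_derivative T g E t"
  shows "has_nabla_derivative T (\<lambda>s. h s - g s) (D - E) t"
  unfolding has_nabla_derivative_iff[OF \<open>t \<in> T\<close>]
proof (intro allI impI)
  let ?r = "backward_jump T t"
  fix \<epsilon> :: real assume "0 < \<epsilon>"
  then have "0 < \<epsilon> / 2" by simp
  obtain d1 where "0 < d1" and d1: "\<And>s. s \<in> T \<Longrightarrow> \<bar>s - t\<bar> < d1 \<Longrightarrow>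
      norm (h ?r - h s - (?r - s) *\<^sub>R D) \<le> \<epsilon> / 2 * \<bar>?r - s\<bar>"
    using h \<open>0 < \<epsilon> / 2\<close> unfolding has_nabla_derivative_iff[OF \<open>t \<in> T\<close>] by blast
  obtain d2 where "0 < d2" and d2: "\<And>s. s \<in> T \<Longrightarrow> \<bar>s - t\<bar> < d2 \<Longrightarrow>
      norm (g ?r - g s - (?r - s) *\<^sub>R E) \<le> \<epsilon> / 2 * \<bar>?r - s\<bar>"
    using g \<open>0 < \<epsilon> / 2\<close> unfolding has_nabla_derivative_iff[OF \<open>t \<in> T\<close>] by blast
  have "norm (h ?r - g ?r - (h s - g s) - (?r - s) *\<^sub>R (D - E)) \<le> \<epsilon> * \<bar>?r - s\<bar>"
    if s: "s \<in> T" "\<bar>s - t\<bar> < min d1 d2" for s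
  proof -
    have "h ?r - g ?r - (h s - g s) - (?r - s) *\<^sub>R (D - E)
        = (h ?r - h s - (?r - s) *\<^sub>R D) - (g ?r - g s - (?r - s) *\<^sub>R E)"
      by (simp add: algebra_simps)
    also have "norm \<dots> \<le> \<epsilon> / 2 * \<bar>?r - s\<bar> + \<epsilon> / 2 * \<bar>?r - s\<bar>"
      using d1 d2 s by (intro order_trans[OF norm_triangle_ineq4 add_mono]) auto
    finally show ?thesis by simp
  qed
  then show "\<exists>\<delta>>0. \<forall>s\<in>T. \<bar>s - t\<bar> < \<delta> \<longrightarrow>
      norm (h ?r - g ?r - (h s - g s) - (?r - s) *\<^sub>R (D - E)) \<le> \<epsilon> * \<bar>?r - s\<bar>"
    using \<open>0 < d1\<close> \<open>0 < d2\<close> by (intro exI[of _ "min d1 d2"]) auto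
qed

lemma has_nabla_derivative_inner_left:
  fixes h :: "real \<Rightarrow> 'a::real_inner"
  assumes "t \<in> T" and h: "has_nabla_derivative T h D t" and "norm u \<le> 1"
  shows "has_nabla_derivative T (\<lambda>s. u \<bullet> h s) (u \<bullet> D) t"
  unfolding has_nabla_derivative_iff[OF \<open>t \<in> T\<close>]
proof (intro allI impI)
  let ?r = "backward_jump T t"
  fix \<epsilon> :: real assume "0 < \<epsilon>"
  then obtain d where "0 < d" and d: "\<And>s. s \<in> T \<Longrightarrow> \<bar>s - t\<bar> < d \<Longrightarrow>
      norm (h ?r - h s - (?r - s) *\<^sub>R D) \<le> \<epsilon> * \<bar>?r - s\<bar>"
    using h unfolding has_nabla_derivative_iff[OF \<open>t \<in> T\<close>] by blast
  have "norm (u \<bullet> h ?r - u \<bullet> h s - (?r - s) *\<^sub>R (u \<bullet> D)) \<le> \<epsilon> * \<bar>?r - s\<bar>"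
    if s: "s \<in> T" "\<bar>s - t\<bar> < d" for s
  proof -
    have "norm (u \<bullet> h ?r - u \<bullet> h s - (?r - s) *\<^sub>R (u \<bullet> D)) = \<bar>u \<bullet> (h ?r - h s - (?r - s) *\<^sub>R D)\<bar>"
      by (simp add: inner_diff_right)
    also have "\<dots> \<le> norm u * norm (h ?r - h s - (?r - s) *\<^sub>R D)" by (rule Cauchy_Schwarz_ineq2)
    also have "\<dots> \<le> 1 * (\<epsilon> * \<bar>?r - s\<bar>)" using d[OF s] \<open>norm u \<le> 1\<close> by (intro mult_mono) auto
    finally show ?thesis by simp
  qed
  then show "\<exists>\<delta>>0. \<forall>s\<in>T. \<bar>s - t\<bar> < \<delta> \<longrightarrow>
      norm (u \<bullet> h ?r - u \<bullet> h s - (?r - s) *\<^sub>R (u \<bullet> D)) \<le> \<epsilon> * \<bar>?r - s\<bar>"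
    using \<open>0 < d\<close> by blast
qed

text \<open>At points that are not left-scattered both sides are \<open>0\<close>.\<close>

lemma has_nabla_derivative_backward_jump:
  assumes "t \<in> T" and h: "has_nabla_derivative T h D t"
  shows "h t - h (backward_jump T t) = (t - backward_jump T t) *\<^sub>R D"
proof -
  let ?r = "backward_jump T t"
  have "norm (h ?r - h t - (?r - t) *\<^sub>R D) \<le> 0 + e" if "0 < e" for e
  proof -
    \<comment> \<open>The defining estimate is evaluated at \<open>s = t\<close>, which lies in
      every neighbourhood; the summand 1 avoids division by zero when \<open>?r = t\<close>.\<close>
    have "0 < e / (\<bar>?r - t\<bar> + 1)" using that by simp
    then have "norm (h ?r - h t - (?r - t) *\<^sub>R D) \<le> e / (\<bar>?r - t\<bar> + 1) * \<bar>?r - t\<bar>"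
      using h \<open>t \<in> T\<close> unfolding has_nabla_derivative_iff[OF \<open>t \<in> T\<close>] by force
    also have "\<dots> \<le> e" using that by (simp add: divide_simps)
    finally show ?thesis by simp
  qed
  then have "norm (h ?r - h t - (?r - t) *\<^sub>R D) \<le> 0" by (rule field_le_epsilon)
  then show ?thesis by (simp add: algebra_simps)
qed

text \<open>By the jump formula, \<open>h s - h t\<close> differs from
  \<open>(s - t) *\<^sub>R D\<close> only by the error in the defining estimate at
  \<open>s\<close>.\<close>

lemma has_nabla_derivative_imp_continuous:
  assumes "t \<in> T" and h: "has_nabla_derivative T h D t"
  shows "continuous (at t within T) h"
  unfolding continuous_within_eps_delta
proof (intro allI impI)
  let ?r = "backward_jump T t"
  fix e :: real assume "0 < e"
  \<comment> \<open>At a left-scattered point \<open>\<bar>?r - s\<bar>\<close> does not tend to 0,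
    so \<open>\<epsilon>\<close> is scaled by the bound \<open>\<bar>?r - t\<bar> + 1\<close>, valid
    for \<open>\<bar>s - t\<bar> < 1\<close>.\<close>
  define \<epsilon> where "\<epsilon> = e / 2 / (\<bar>?r - t\<bar> + 1)"
  have "0 < \<epsilon>" using \<open>0 < e\<close> by (simp add: \<epsilon>_def add_nonneg_pos)
  then obtain d where "0 < d" and d: "\<And>s. s \<in> T \<Longrightarrow> \<bar>s - t\<bar> < d \<Longrightarrow>
      norm (h ?r - h s - (?r - s) *\<^sub>R D) \<le> \<epsilon> * \<bar>?r - s\<bar>"
    using h unfolding has_nabla_derivative_iff[OF \<open>t \<in> T\<close>] by blast
  define d' where "d' = min (min d 1) (e / 2 / (norm D + 1))"
  have "0 < norm D + 1" by (simp add: add_nonneg_pos)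
  then have "0 < d'" using \<open>0 < d\<close> \<open>0 < e\<close> by (simp add: d'_def)
  have "dist (h s) (h t) < e" if "s \<in> T" "dist s t < d'" for s
  proof -
    have s: "\<bar>s - t\<bar> < d" "\<bar>s - t\<bar> < 1" "\<bar>s - t\<bar> < e / 2 / (norm D + 1)"
      using that by (auto simp: d'_def dist_real_def)
    have "h s - h t = (t - ?r) *\<^sub>R - D - (h ?r - h s)"
      using has_nabla_derivative_backward_jump[OF assms] by (simp add: algebra_simps)
    also have "\<dots> = - (h ?r - h s - (?r - s) *\<^sub>R D) + (s - t) *\<^sub>R D"
      by (simp add: algebra_simps)
    also have "norm \<dots> \<le> \<epsilon> * \<bar>?r - s\<bar> + \<bar>s - t\<bar> * norm D"
      using d[OF \<open>s \<in> T\<close> s(1)]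
      by (intro order_trans[OF norm_triangle_ineq add_mono]) (simp_all only: norm_minus_cancel norm_scaleR order_refl)
    also have "\<dots> < e / 2 + e / 2"
    proof (rule add_le_less_mono)
      have "\<epsilon> * \<bar>?r - s\<bar> \<le> \<epsilon> * (\<bar>?r - t\<bar> + 1)"
        using s(2) \<open>0 < \<epsilon>\<close> by (intro mult_left_mono) auto
      also have "\<dots> = e / 2"
      proof -
        have "\<bar>?r - t\<bar> + 1 \<noteq> 0" by linarith
        then show ?thesis unfolding \<epsilon>_def by (rule nonzero_eq_divide_eq[THEN iffD1]) (rule refl)
      qed
      finally show "\<epsilon> * \<bar>?r - s\<bar> \<le> e / 2" .
      have "\<bar>s - t\<bar> * norm D \<le> \<bar>s - t\<bar> * (norm D + 1)" by (intro mult_left_mono) auto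
      also have "\<dots> < e / 2"
        using s(3) \<open>0 < norm D + 1\<close> by (simp only: pos_less_divide_eq)
      finally show "\<bar>s - t\<bar> * norm D < e / 2" .
    qed
    finally show ?thesis by (simp add: dist_norm)
  qed
  with \<open>0 < d'\<close> show "\<exists>d>0. \<forall>s\<in>T. dist s t < d \<longrightarrow> dist (h s) (h t) < e" by blast
qed

lemma continuous_on_imp_ld_continuous_on:
  assumes "continuous_on S g"
  shows "ld_continuous_on T S g"
  unfolding ld_continuous_on_def
proof (intro conjI ballI impI)
  fix t assume "t \<in> S"
  then show "continuous (at t within S) g"
    using assms by (simp add: continuous_on_eq_continuous_within)
  then show "\<exists>l. (g \<longlongrightarrow> l) (at t within (S \<inter> {t<..}))"
    unfolding continuous_within by (blast intro: tendsto_within_subset)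
qed

section \<open>Bounded time scales: jumps, uniqueness of nabla derivatives, and the nabla
  integral\<close>

locale bounded_time_scale =
  fixes T :: "real set" and a b :: real
  assumes time_scale: "time_scale T"
    and a_in: "a \<in> T" and a_le: "\<And>t. t \<in> T \<Longrightarrow> a \<le> t"
    and b_in: "b \<in> T" and le_b: "\<And>t. t \<in> T \<Longrightarrow> t \<le> b"
begin

lemma closed_T: "closed T"
  using time_scale by (simp add: time_scale_def)

lemma a_le_b: "a \<le> b"
  using a_le b_in by blast

lemma nabla_domain_subset: "nabla_domain T \<subseteq> T"
  by (auto simp: nabla_domain_def)

lemma nabla_domain_memI: "t \<in> T \<Longrightarrow> a < t \<Longrightarrow> t \<in> nabla_domain T"
  using a_in by (force simp: nabla_domain_def)

text \<open>A right-scattered minimum is isolated: all other points lie in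
  \<open>{forward_jump T a..}\<close>. Removing it therefore keeps the set closed.\<close>

lemma compact_nabla_domain: "compact (nabla_domain T)"
proof -
  have "closed (nabla_domain T)"
  proof (cases "forward_jump T a > a")
    case True
    have ne: "{s \<in> T. s > a} \<noteq> {}" using True by (metis forward_jump_def less_irrefl)
    have "forward_jump T a \<le> s" if "s \<in> T" "s > a" for s
      using ne that by (auto simp: forward_jump_def intro!: cInf_lower bdd_belowI[of _ a])
    moreover have "nabla_domain T = T - {a}"
      using True a_in a_le by (auto simp: nabla_domain_def intro: antisym)
    ultimately have "nabla_domain T = T \<inter> {forward_jump T a..}"
      using True a_le by fastforce
    then show ?thesis using closed_T by auto
  next
    case False
    then have "nabla_domain T = T" using a_in a_le by (auto simp: nabla_domain_def dest: antisym)
    then show ?thesis using closed_T by simp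
  qed
  moreover have "bounded (nabla_domain T)"
    by (rule bounded_subset[OF bounded_closed_interval[of a b]])
       (use nabla_domain_subset a_le le_b in auto)
  ultimately show ?thesis by (simp add: compact_eq_bounded_closed)
qed

lemma backward_jump_le: "backward_jump T t \<le> t"
  by (auto simp: backward_jump_def intro: cSup_least)

lemma le_backward_jump: "s \<in> T \<Longrightarrow> s < t \<Longrightarrow> s \<le> backward_jump T t"
  by (auto simp: backward_jump_def intro!: cSup_upper bdd_aboveI[of _ t])

lemma backward_jump_mem:
  assumes "t \<in> T"
  shows "backward_jump T t \<in> T"
proof (cases "{s \<in> T. s < t} = {}")
  case False
  have "Sup {s \<in> T. s < t} \<in> T"
    using closed_T False by (intro closed_subset_contains_Sup) (auto intro!: bdd_aboveI[of _ t])
  then show ?thesis using False by (simp only: backward_jump_def if_False)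
qed (use assms in \<open>simp add: backward_jump_def\<close>)

lemma left_dense_approach:
  assumes "a < t" "backward_jump T t = t" "0 < d"
  obtains s where "s \<in> T" "s < t" "t - d < s"
proof -
  have ne: "{s \<in> T. s < t} \<noteq> {}" using a_in \<open>a < t\<close> by auto
  then have "t - d < Sup {s \<in> T. s < t}"
    using assms by (simp only: backward_jump_def if_False)
  then obtain s where "s \<in> {s \<in> T. s < t}" "t - d < s" using less_cSupD[OF ne] by blast
  then show ?thesis by (intro that[of s]) auto
qed

text \<open>Such a \<open>t\<close> is left-dense or equal to \<open>a\<close>, where
  \<open>backward_jump T a = a\<close> holds by convention. In the latter case membership in
  \<open>nabla_domain T\<close> excludes a jump to the right, and \<open>a < b\<close> supplies
  points there.\<close>

lemma dense_approach:
  assumes "a < b" "t \<in> nabla_domain T" "backward_jump T t = t" "0 < d"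
  obtains s where "s \<in> T" "s \<noteq> t" "\<bar>s - t\<bar> < d"
proof (cases "a < t")
  case True
  then obtain s where "s \<in> T" "s < t" "t - d < s"
    using left_dense_approach[OF True assms(3,4)] by metis
  then show ?thesis by (intro that[of s]) auto
next
  case False
  then have "t = a" using assms(2) a_le nabla_domain_subset by force
  then have "\<not> forward_jump T a > a" using assms(2) a_in a_le by (auto simp: nabla_domain_def)
  moreover have ne: "{s \<in> T. s > a} \<noteq> {}" using \<open>a < b\<close> b_in by auto
  ultimately have "Inf {s \<in> T. s > a} < a + d"
    using \<open>0 < d\<close> by (simp only: forward_jump_def if_False)
  then obtain s where "s \<in> T" "a < s" "s < a + d"
    using cInf_lessD[OF ne] by blast
  then show ?thesis using \<open>t = a\<close> by (intro that[of s]) auto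
qed

text \<open>At a left-scattered point the jump formula determines the derivative. Elsewhere
  \<open>D - E\<close> is a derivative of the zero function, and points \<open>s \<noteq> t\<close>
  arbitrarily close to \<open>t\<close> force its norm below every positive bound.\<close>

lemma has_nabla_derivative_unique:
  assumes "a < b" and t: "t \<in> nabla_domain T"
    and D: "has_nabla_derivative T h D t" and E: "has_nabla_derivative T h E t"
  shows "D = E"
proof (cases "backward_jump T t = t")
  case False
  have "t \<in> T" using t nabla_domain_subset by blast
  then show ?thesis
    using has_nabla_derivative_backward_jump[OF _ D] has_nabla_derivative_backward_jump[OF _ E] False
    by simp
next
  case True
  have "t \<in> T" using t nabla_domain_subset by blast
  have "norm (D - E) \<le> 0 + e" if "0 < e" for e
  proof -
    have 0: "has_nabla_derivative T (\<lambda>s. h s - h s) (D - E) t"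
      by (rule has_nabla_derivative_diff[OF \<open>t \<in> T\<close> D E])
    obtain d where "0 < d"
      and d: "\<And>s. s \<in> T \<Longrightarrow> \<bar>s - t\<bar> < d \<Longrightarrow> norm (h t - h t - (h s - h s) - (t - s) *\<^sub>R (D - E)) \<le> e * \<bar>t - s\<bar>"
      using 0[unfolded has_nabla_derivative_iff[OF \<open>t \<in> T\<close>] True, rule_format, OF \<open>0 < e\<close>] by blast
    obtain s where "s \<in> T" "s \<noteq> t" "\<bar>s - t\<bar> < d"
      using dense_approach[OF \<open>a < b\<close> t True \<open>0 < d\<close>] .
    then have "\<bar>t - s\<bar> * norm (D - E) \<le> \<bar>t - s\<bar> * e" using d[of s] by (simp add: mult.commute[of e])
    then show ?thesis using \<open>s \<noteq> t\<close> by simp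
  qed
  then have "norm (D - E) \<le> 0" by (rule field_le_epsilon)
  then show ?thesis by simp
qed

lemma nabla_deriv_eqI:
  assumes "a < b" "t \<in> nabla_domain T" "has_nabla_derivative T h D t"
  shows "nabla_differentiable T h t" "nabla_deriv T h t = D"
  using assms has_nabla_derivative_unique
  unfolding nabla_differentiable_def nabla_deriv_def by (blast intro: the_equality)+

text \<open>With a single point, \<open>s\<close>, \<open>t\<close> and
  \<open>backward_jump T t\<close> coincide, so every vector satisfies the defining estimate and
  uniqueness fails. The differentiability required of a tube solution thus forces
  \<open>a < b\<close>.\<close>

lemma singleton_not_nabla_differentiable:
  fixes h :: "real \<Rightarrow> 'a::euclidean_space"
  assumes "a = b"
  shows "a \<in> nabla_domain T" "\<not> nabla_differentiable T h a"
proof -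
  have T: "T = {a}" using assms a_in a_le le_b by (auto intro: antisym)
  then show "a \<in> nabla_domain T" by (simp add: nabla_domain_def forward_jump_def)
  have "backward_jump T a = a" by (auto simp: T backward_jump_def)
  then have "has_nabla_derivative T h D a" for D
    by (subst has_nabla_derivative_iff) (auto simp: T intro: exI[of _ 1])
  moreover obtain i :: 'a where "i \<in> Basis" using nonempty_Basis by blast
  ultimately show "\<not> nabla_differentiable T h a"
    unfolding nabla_differentiable_def using nonzero_Basis by metis
qed

text \<open>At a left-scattered \<open>t\<close> the point \<open>backward_jump T t\<close> serves,
  by the exact jump formula. Otherwise a point slightly to the left works: with tolerance
  \<open>- D / 2\<close>, half of the slope survives.\<close>

lemma nabla_derivative_neg_imp_greater_left:
  fixes \<phi> :: "real \<Rightarrow> real"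
  assumes "t \<in> T" "a < t" and D: "has_nabla_derivative T \<phi> D t" and "D < 0"
  obtains s where "s \<in> T" "\<phi> t < \<phi> s"
proof (cases "backward_jump T t = t")
  case False
  then have "backward_jump T t < t" using backward_jump_le[of t] by simp
  then have "(t - backward_jump T t) *\<^sub>R D < 0" using \<open>D < 0\<close> by (simp add: mult_pos_neg)
  then show ?thesis
    using that[OF backward_jump_mem[OF \<open>t \<in> T\<close>]]
      has_nabla_derivative_backward_jump[OF \<open>t \<in> T\<close> D] by simp
next
  case True
  have "0 < - D / 2" using \<open>D < 0\<close> by simp
  then obtain d where "0 < d" and d: "\<And>s. s \<in> T \<Longrightarrow> \<bar>s - t\<bar> < d \<Longrightarrow>
      norm (\<phi> t - \<phi> s - (t - s) *\<^sub>R D) \<le> - D / 2 * \<bar>t - s\<bar>"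
    using D unfolding has_nabla_derivative_iff[OF \<open>t \<in> T\<close>] True by blast
  obtain s where s: "s \<in> T" "s < t" "t - d < s"
    using left_dense_approach[OF \<open>a < t\<close> True \<open>0 < d\<close>] .
  then have "\<bar>\<phi> t - \<phi> s - (t - s) * D\<bar> \<le> - D / 2 * (t - s)" using d[of s] by simp
  then have "\<phi> t - \<phi> s - (t - s) * D \<le> - ((t - s) * D / 2)" by (simp add: mult.commute)
  then have "\<phi> t - \<phi> s \<le> (t - s) * D / 2" by simp
  also have "\<dots> < 0" using \<open>D < 0\<close> s by (simp add: mult_pos_neg)
  finally show ?thesis using s by (intro that[of s]) auto
qed

text \<open>Composition with \<open>next_point\<close> turns the nabla integral into an ordinary one:
  \<open>\<integral>\<^bsub>[a,t]\<^esub> h(s) \<nabla>s = \<integral>\<^bsub>[a,t]\<^esub> h(next_point s) ds\<close>. The \<open>min\<close> only keeps the infimum away from the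
  empty set.\<close>

definition next_point :: "real \<Rightarrow> real" where
  "next_point s = Inf (nabla_domain T \<inter> {min s b..})"

context
  assumes "a < b"
begin

lemma next_point_mem: "next_point s \<in> nabla_domain T"
  and le_next_point: "s \<le> b \<Longrightarrow> s \<le> next_point s"
  and next_point_le: "u \<in> nabla_domain T \<Longrightarrow> s \<le> u \<Longrightarrow> next_point s \<le> u"
  and mono_next_point: "mono next_point"
proof -
  have ne: "nabla_domain T \<inter> {min s b..} \<noteq> {}" for s
    using nabla_domain_memI[OF b_in \<open>a < b\<close>] by force
  have bdd: "bdd_below (nabla_domain T \<inter> {min s b..})" for s
    by (auto intro: bdd_belowI[of _ "min s b"])
  have mem: "next_point s \<in> nabla_domain T \<inter> {min s b..}" for s
    unfolding next_point_def
    using ne bdd compact_imp_closed[OF compact_nabla_domain] by (intro closed_contains_Inf) auto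
  then show "next_point s \<in> nabla_domain T" by blast
  show "s \<le> next_point s" if "s \<le> b" using mem[of s] that by simp
  show "next_point s \<le> u" if "u \<in> nabla_domain T" "s \<le> u"
    unfolding next_point_def using bdd that by (intro cInf_lower) auto
  show "mono next_point"
    unfolding next_point_def by (intro monoI cInf_superset_mono ne bdd) auto
qed

text \<open>This is the fundamental theorem of calculus for the nabla integral. On
  \<open>{r..s}\<close> with \<open>s\<close> in \<open>nabla_domain T\<close>,
  \<open>next_point\<close> takes values in \<open>{r..s}\<close> only, so continuity of
  \<open>h\<close> at \<open>t\<close> controls the integrand near \<open>t\<close>. Across a gap to
  the left of \<open>t\<close> the integrand is constantly \<open>h t\<close>, so the jump is
  exact.\<close>

lemma has_nabla_derivative_integral:
  fixes h :: "real \<Rightarrow> 'a::euclidean_space"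
  assumes h: "continuous_on (nabla_domain T) h"
    and x: "\<And>r. r \<in> {a..b} \<Longrightarrow> x r = c + integral {a..r} (\<lambda>s. h (next_point s))"
    and t: "t \<in> nabla_domain T"
  shows "has_nabla_derivative T x (h t) t"
proof -
  let ?r = "backward_jump T t"
  have "t \<in> T" using t nabla_domain_subset by blast
  have int: "(\<lambda>s. h (next_point s)) integrable_on {c..d}" for c d
    by (rule integrable_continuous_comp_mono[OF compact_nabla_domain mono_next_point next_point_mem h])
  have x_diff: "x s - x r = integral {r..s} (\<lambda>s. h (next_point s))"
    if "r \<in> T" "s \<in> T" "r \<le> s" for r s
    using Henstock_Kurzweil_Integration.integral_combine[OF a_le[OF that(1)] that(3) int]
      x[of r] x[of s] that a_le le_b by (auto simp: algebra_simps)
  have approx: "norm (x s - x r - (s - r) *\<^sub>R D) \<le> e * (s - r)"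
    if rs: "r \<in> T" "s \<in> T" "r \<le> s" "s \<in> nabla_domain T"
      and e: "\<And>u. u \<in> nabla_domain T \<Longrightarrow> r \<le> u \<Longrightarrow> u \<le> s \<Longrightarrow> norm (h u - D) \<le> e" for r s D e
  proof -
    have "r \<le> next_point u \<and> next_point u \<le> s" if "u \<in> {r..s}" for u
      using that le_next_point[of u] next_point_le[OF rs(4), of u] le_b[OF rs(2)] by auto
    then show ?thesis
      unfolding x_diff[OF rs(1-3)]
      by (intro integral_minus_const_bound int rs e next_point_mem) auto
  qed
  have near: "norm (x t - x s - (t - s) *\<^sub>R h t) \<le> e * \<bar>t - s\<bar>"
    if s: "s \<in> T" and e: "\<And>u. u \<in> nabla_domain T \<Longrightarrow> \<bar>u - t\<bar> \<le> \<bar>s - t\<bar> \<Longrightarrow> norm (h u - h t) \<le> e" for s e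
  proof (cases "s \<le> t")
    case True
    then show ?thesis
      using approx[OF s \<open>t \<in> T\<close> True t, of "h t" e] e by simp
  next
    case False
    then have "s \<in> nabla_domain T" using s a_le[OF \<open>t \<in> T\<close>] by (intro nabla_domain_memI) auto
    then have "norm (x s - x t - (s - t) *\<^sub>R h t) \<le> e * (s - t)"
      using approx[OF \<open>t \<in> T\<close> s, of "h t" e] e False by simp
    moreover have "x t - x s - (t - s) *\<^sub>R h t = - (x s - x t - (s - t) *\<^sub>R h t)"
      by (simp add: algebra_simps)
    ultimately show ?thesis using False by (metis abs_minus_commute abs_of_nonneg diff_ge_0_iff_ge nle_le norm_minus_cancel)
  qed
  have cont: "\<exists>d>0. \<forall>u\<in>nabla_domain T. \<bar>u - t\<bar> < d \<longrightarrow> norm (h u - h t) \<le> e" if "0 < e" for e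
    using h t that unfolding continuous_on_iff dist_norm real_norm_def by (meson less_imp_le)
  show ?thesis
    unfolding has_nabla_derivative_iff[OF \<open>t \<in> T\<close>]
  proof (intro allI impI)
    fix e :: real assume "0 < e"
    show "\<exists>d>0. \<forall>s\<in>T. \<bar>s - t\<bar> < d \<longrightarrow> norm (x ?r - x s - (?r - s) *\<^sub>R h t) \<le> e * \<bar>?r - s\<bar>"
    proof (cases "?r = t")
      case True
      obtain d where "0 < d" "\<forall>u\<in>nabla_domain T. \<bar>u - t\<bar> < d \<longrightarrow> norm (h u - h t) \<le> e"
        using cont[OF \<open>0 < e\<close>] by blast
      then have "\<forall>s\<in>T. \<bar>s - t\<bar> < d \<longrightarrow> norm (x t - x s - (t - s) *\<^sub>R h t) \<le> e * \<bar>t - s\<bar>"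
        using near by force
      with \<open>0 < d\<close> show ?thesis unfolding True by blast
    next
      case False
      then have "?r < t" using backward_jump_le[of t] by simp
      have "?r \<in> T" by (rule backward_jump_mem[OF \<open>t \<in> T\<close>])
      have "next_point u = t" if "u \<in> {?r<..t}" for u
      proof -
        have "u \<le> next_point u" using that le_b[OF \<open>t \<in> T\<close>] by (intro le_next_point) auto
        moreover have "next_point u \<le> t" using that t by (intro next_point_le) auto
        moreover have "next_point u \<in> T" using next_point_mem nabla_domain_subset by blast
        ultimately show ?thesis
          using le_backward_jump[of "next_point u" t] that by fastforce
      qed
      \<comment> \<open>The left end is excepted because \<open>next_point ?r\<close> can be
        \<open>?r\<close>; a single point does not affect the integral.\<close>
      then have "integral {?r..t} (\<lambda>s. h (next_point s)) = integral {?r..t} (\<lambda>s. h t)"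
        by (intro integral_spike[of "{?r}"]) auto
      then have jump: "x t - x ?r = (t - ?r) *\<^sub>R h t"
        using x_diff[OF \<open>?r \<in> T\<close> \<open>t \<in> T\<close>] \<open>?r < t\<close> by simp
      obtain d where "0 < d" and d: "\<forall>u\<in>nabla_domain T. \<bar>u - t\<bar> < d \<longrightarrow> norm (h u - h t) \<le> 1"
        using cont[of 1] by auto
      \<comment> \<open>Near a left-scattered \<open>t\<close> the factor
        \<open>\<bar>?r - s\<bar>\<close> is at least half the gap, whereas the error is at most
        \<open>\<bar>t - s\<bar>\<close>; so the crude bound 1 on the oscillation of
        \<open>h\<close> suffices.\<close>
      define d' where "d' = min (min d ((t - ?r) / 2)) (e * ((t - ?r) / 2))"
      have "0 < d'" using \<open>0 < d\<close> \<open>?r < t\<close> \<open>0 < e\<close> by (simp add: d'_def)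
      moreover have "norm (x ?r - x s - (?r - s) *\<^sub>R h t) \<le> e * \<bar>?r - s\<bar>"
        if "s \<in> T" "\<bar>s - t\<bar> < d'" for s
      proof -
        have s: "\<bar>s - t\<bar> < d" "\<bar>s - t\<bar> < (t - ?r) / 2" "\<bar>s - t\<bar> < e * ((t - ?r) / 2)"
          using that(2) by (auto simp: d'_def)
        have "x ?r - x s - (?r - s) *\<^sub>R h t = x t - x s - (t - s) *\<^sub>R h t"
          using jump by (simp add: algebra_simps)
        also have "norm \<dots> \<le> 1 * \<bar>t - s\<bar>"
          using near[OF \<open>s \<in> T\<close>, of 1] d s(1) by force
        also have "\<dots> \<le> e * ((t - ?r) / 2)" using s(3) by (simp add: abs_minus_commute)
        also have "\<dots> \<le> e * \<bar>?r - s\<bar>"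
        proof (rule mult_left_mono)
          have "t - s \<le> \<bar>s - t\<bar>" by simp
          with s(2) have "t - s < (t - ?r) / 2" by linarith
          then have "(t - ?r) / 2 \<le> s - ?r" by (simp add: field_simps)
          moreover have "s - ?r \<le> \<bar>?r - s\<bar>" by simp
          ultimately show "(t - ?r) / 2 \<le> \<bar>?r - s\<bar>" by linarith
        qed (use \<open>0 < e\<close> in simp)
        finally show ?thesis .
      qed
      ultimately show ?thesis by blast
    qed
  qed
qed

end

end

section \<open>The projection onto the tube\<close>

text \<open>Dividing by a \<open>max\<close> instead of distinguishing cases makes joint continuity
  immediate as long as \<open>m\<close> is positive, even at \<open>z = c\<close>.\<close>

definition tube_proj :: "'a::real_normed_vector \<Rightarrow> real \<Rightarrow> 'a \<Rightarrow> 'a" where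
  "tube_proj c m z = c + (m / max m (norm (z - c))) *\<^sub>R (z - c)"

lemma tube_proj_inside: "0 < m \<Longrightarrow> norm (z - c) \<le> m \<Longrightarrow> tube_proj c m z = z"
  by (simp add: tube_proj_def max_absorb1)

lemma norm_tube_proj_outside: "0 < m \<Longrightarrow> m \<le> norm (z - c) \<Longrightarrow> norm (tube_proj c m z - c) = m"
  by (auto simp: tube_proj_def max_absorb2)

lemma norm_tube_proj_le: "0 < m \<Longrightarrow> norm (tube_proj c m z - c) \<le> m"
  by (cases "norm (z - c) \<le> m") (simp_all add: tube_proj_inside norm_tube_proj_outside)

lemma continuous_on_tube_proj:
  assumes "continuous_on S c" "continuous_on S m" "continuous_on S z" "\<And>s. s \<in> S \<Longrightarrow> 0 < m s"
  shows "continuous_on S (\<lambda>s. tube_proj (c s) (m s) (z s))"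
  unfolding tube_proj_def
  using assms(4) by (intro continuous_intros assms(1-3)) (auto dest!: assms(4))

section \<open>Existence of a solution in the tube\<close>

theorem theorem3p3:
  fixes T :: "real set" and a b :: real
    and f :: "real \<Rightarrow> real^'n \<Rightarrow> real^'n"
    and v :: "real \<Rightarrow> real^'n" and M :: "real \<Rightarrow> real"
  assumes "time_scale T" and "bounded T"
    and "a \<in> T" and "\<And>t. t \<in> T \<Longrightarrow> a \<le> t"
    and "b \<in> T" and "\<And>t. t \<in> T \<Longrightarrow> t \<le> b"
    and "continuous_on (nabla_domain T \<times> UNIV) (\<lambda>(t, x). f t x)"
    and "tube_solution T a b f v M"
  shows "\<exists>x. periodic_solution T a b f x \<and> (\<forall>t\<in>T. norm (x t - v t) \<le> M t)"
proof -
  interpret bounded_time_scale T a b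
    by unfold_locales (use assms in auto)
  let ?K = "nabla_domain T"
  note f_cont = assms(7)
  have v_diff: "\<And>t. t \<in> ?K \<Longrightarrow> nabla_differentiable T v t"
    and M_diff: "\<And>t. t \<in> ?K \<Longrightarrow> nabla_differentiable T M t"
    and M_nonneg: "\<And>t. t \<in> T \<Longrightarrow> 0 \<le> M t"
    and tube: "\<And>t x. t \<in> ?K \<Longrightarrow> norm (x - v t) = M t \<Longrightarrow>
      (x - v t) \<bullet> (f t x - nabla_deriv T v t) + M t * norm (x - v t) \<le> M t * nabla_deriv T M t"
    and tube0: "\<And>t x. t \<in> ?K \<Longrightarrow> M t = 0 \<Longrightarrow> norm (x - v t) - nabla_deriv T M t < 0"
    and tube_ab: "norm (v a - v b) \<le> M a - M b"
    using assms(8) by (auto simp: tube_solution_def C1_ld_def)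
  have "a < b"
    using singleton_not_nabla_differentiable(1) singleton_not_nabla_differentiable(2)[of v] v_diff a_le_b
    by fastforce
  have v: "has_nabla_derivative T v (nabla_deriv T v t) t" if "t \<in> ?K" for t
    using v_diff[OF that] unfolding nabla_differentiable_def nabla_deriv_def by (rule theI')
  have M: "has_nabla_derivative T M (nabla_deriv T M t) t" if "t \<in> ?K" for t
    using M_diff[OF that] unfolding nabla_differentiable_def nabla_deriv_def by (rule theI')
  have KT: "t \<in> T" if "t \<in> ?K" for t using that nabla_domain_subset by blast
  \<comment> \<open>Condition (2) of a tube solution can never be met where \<open>M\<close> vanishes, as \<open>norm (x - v t)\<close> is unbounded in \<open>x\<close>.\<close>
  have M_pos: "0 < M t" if "t \<in> ?K" for t
  proof (rule ccontr)
    assume "\<not> 0 < M t"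
    then have "M t = 0" using M_nonneg[OF KT[OF that]] by simp
    obtain y :: "real^'n" where "norm y = \<bar>nabla_deriv T M t\<bar>"
      using vector_choose_size[of "\<bar>nabla_deriv T M t\<bar>"] by auto
    then show False using tube0[OF that \<open>M t = 0\<close>, of "y + v t"] by simp
  qed
  have "b \<in> ?K" by (rule nabla_domain_memI[OF b_in \<open>a < b\<close>])
  \<comment> \<open>The point \<open>a\<close> may lie outside \<open>?K\<close>, so positivity
    there comes from condition (3), which gives \<open>M b \<le> M a\<close>.\<close>
  have "0 < M a" using tube_ab M_pos[OF \<open>b \<in> ?K\<close>] norm_ge_zero[of "v a - v b"] by linarith
  have cont: "continuous_on ?K v" "continuous_on ?K M"
    using has_nabla_derivative_imp_continuous[OF KT v] has_nabla_derivative_imp_continuous[OF KT M]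
      nabla_domain_subset
    by (auto simp: continuous_on_eq_continuous_within intro: continuous_within_subset)
  define P where "P t z = tube_proj (v t) (M t) z" for t z
  define F where "F t z = f t (P t z)" for t z
  have P_cont: "continuous_on (?K \<times> UNIV) (\<lambda>(t, z). P t z)"
    unfolding P_def case_prod_beta
    by (intro continuous_on_tube_proj continuous_intros continuous_on_compose2[OF cont(1)]
        continuous_on_compose2[OF cont(2)]) (auto intro: M_pos)
  have F_cont: "continuous_on (?K \<times> UNIV) (\<lambda>(t, z). F t z)"
  proof -
    have "continuous_on (?K \<times> UNIV) (\<lambda>p. (fst p, P (fst p) (snd p)))"
      using P_cont by (intro continuous_intros) (simp add: case_prod_beta)
    from continuous_on_compose2[OF f_cont this] show ?thesis
      by (simp add: F_def case_prod_beta image_subset_iff mem_Times_iff)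
  qed
  \<comment> \<open>\<open>P t z\<close> stays in the tube, which over the compact \<open>?K\<close>
    lies in a fixed ball; there \<open>f\<close> is bounded, which makes the bound uniform in
    \<open>z\<close>.\<close>
  obtain C where C: "\<And>t z. t \<in> ?K \<Longrightarrow> norm (F t z) \<le> C"
  proof -
    have "bounded (v ` ?K)" "bounded (M ` ?K)"
      by (intro compact_imp_bounded compact_continuous_image cont compact_nabla_domain)+
    then obtain c1 c2 where c: "\<And>t. t \<in> ?K \<Longrightarrow> norm (v t) \<le> c1" "\<And>t. t \<in> ?K \<Longrightarrow> norm (M t) \<le> c2"
      unfolding bounded_iff by blast
    have P_in: "P t z \<in> cball 0 (c1 + c2)" if "t \<in> ?K" for t z
    proof -
      have "norm (P t z) \<le> norm (v t) + norm (P t z - v t)" by (rule norm_triangle_sub)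
      also have "\<dots> \<le> c1 + c2"
        using c[OF that] norm_tube_proj_le[OF M_pos[OF that], of "v t" z] by (simp add: P_def)
      finally show ?thesis by simp
    qed
    have "bounded ((\<lambda>(t, z). f t z) ` (?K \<times> cball 0 (c1 + c2)))"
      by (intro compact_imp_bounded compact_continuous_image compact_Times compact_nabla_domain compact_cball
          continuous_on_subset[OF f_cont]) auto
    then obtain C where C: "\<And>w. w \<in> (\<lambda>(t, z). f t z) ` (?K \<times> cball 0 (c1 + c2)) \<Longrightarrow> norm w \<le> C"
      unfolding bounded_iff by blast
    show thesis
    proof (rule that)
      fix t z assume "t \<in> ?K"
      then have "(\<lambda>(t, z). f t z) (t, P t z) \<in> (\<lambda>(t, z). f t z) ` (?K \<times> cball 0 (c1 + c2))"
        using P_in by (intro imageI) simp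
      then show "norm (F t z) \<le> C" unfolding F_def using C by simp
    qed
  qed
  have K_sub: "?K \<subseteq> {a..b}" using KT a_le le_b by auto
  have Pa_cont: "continuous_on UNIV (P a)"
    unfolding P_def using \<open>0 < M a\<close> by (intro continuous_on_tube_proj continuous_intros)
  have Pa_bound: "norm (P a z) \<le> norm (v a) + M a" for z
    using norm_triangle_sub[of "P a z" "v a"] norm_tube_proj_le[OF \<open>0 < M a\<close>, of "v a" z]
    by (simp add: P_def)
  \<comment> \<open>With \<open>next_point\<close> as \<open>\<tau>\<close> the integral is a nabla
    integral, so differentiation gives the modified equation, and \<open>r = a\<close> gives
    \<open>x a = P a (x b)\<close>.\<close>
  obtain x where x_cont: "continuous_on {a..b} x"
    and x: "\<And>r. r \<in> {a..b} \<Longrightarrow> x r = P a (x b) + integral {a..r} (\<lambda>s. F (next_point s) (x (next_point s)))"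
  proof (rule periodic_integral_equation[OF a_le_b compact_nabla_domain K_sub mono_next_point[OF \<open>a < b\<close>]
        next_point_mem[OF \<open>a < b\<close>] F_cont C Pa_cont Pa_bound])
    fix x
    assume "continuous_on {a..b} x"
      "\<And>r. r \<in> {a..b} \<Longrightarrow> x r = P a (x b) + integral {a..r} (\<lambda>s. F (next_point s) (x (next_point s)))"
    then show thesis by (rule that)
  qed
  have x_a: "x a = P a (x b)" using x[of a] a_le_b by simp
  have Fx_cont: "continuous_on ?K (\<lambda>t. F t (x t))"
  proof -
    have "continuous_on ?K x" by (rule continuous_on_subset[OF x_cont K_sub])
    then have "continuous_on ?K (\<lambda>t. (t, x t))" by (intro continuous_on_Pair continuous_on_id)
    then show ?thesis using continuous_on_compose2[OF F_cont, of ?K "\<lambda>t. (t, x t)"] by auto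
  qed
  have x_deriv: "has_nabla_derivative T x (F t (x t)) t" if "t \<in> ?K" for t
    by (rule has_nabla_derivative_integral[OF \<open>a < b\<close> Fx_cont x that])
  have in_tube: "norm (x t - v t) \<le> M t" if "t \<in> T" for t
  proof -
    define r where "r t = norm (x t - v t) - M t" for t
    have r_a: "r a \<le> 0" using norm_tube_proj_le[OF \<open>0 < M a\<close>] by (simp add: r_def x_a P_def)
    have "continuous_on ?K x" by (rule continuous_on_subset[OF x_cont K_sub])
    then have "continuous_on ?K r" unfolding r_def by (intro continuous_intros cont)
    \<comment> \<open>Only \<open>a\<close> can be missing from \<open>?K\<close>, and
      \<open>r a \<le> 0\<close> because \<open>x a\<close> is a projected point; so a positive
      maximum over \<open>?K\<close> is one over \<open>T\<close>, attained to the right of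
      \<open>a\<close>.\<close>
    then obtain \<mu> where \<mu>: "\<mu> \<in> ?K" "\<And>s. s \<in> ?K \<Longrightarrow> r s \<le> r \<mu>"
      using continuous_attains_sup[OF compact_nabla_domain, of r] \<open>b \<in> ?K\<close> by blast
    have "r \<mu> \<le> 0"
    proof (rule ccontr)
      assume "\<not> r \<mu> \<le> 0"
      then have "r a < r \<mu>" using r_a by simp
      then have "a < \<mu>" using a_le[OF KT[OF \<mu>(1)]] by (auto simp: le_less)
      have max: "r s \<le> r \<mu>" if "s \<in> T" for s
        using \<mu>(2)[of s] nabla_domain_memI[OF that] a_le[OF that] \<open>r a < r \<mu>\<close> by force
      let ?m = "M \<mu>" and ?y = "x \<mu> - v \<mu>" and ?V = "nabla_deriv T v \<mu>" and ?M' = "nabla_deriv T M \<mu>"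
      define u where "u = ?y /\<^sub>R norm ?y"
      have m: "0 < ?m" "?m < norm ?y" using M_pos[OF \<mu>(1)] \<open>\<not> r \<mu> \<le> 0\<close> by (auto simp: r_def)
      have "norm ?y \<noteq> 0" using m by linarith
      then have "norm u = 1" and uy: "u \<bullet> ?y = norm ?y"
        by (auto simp: u_def dot_square_norm power2_eq_square)
      have Py: "P \<mu> (x \<mu>) - v \<mu> = ?m *\<^sub>R u"
        using m by (simp add: P_def tube_proj_def u_def max_absorb2 divide_inverse)
      \<comment> \<open>\<open>P \<mu> (x \<mu>)\<close> lies on the boundary sphere of the tube, so
        condition (1) applies to it, and \<open>f \<mu>\<close> takes the value
        \<open>F \<mu> (x \<mu>)\<close> there. After division by \<open>?m\<close>, the term
        \<open>M t * norm (x - v t)\<close> of the condition leaves the margin \<open>- ?m\<close>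
        that makes the inequality strict.\<close>
      have "?m * (u \<bullet> (F \<mu> (x \<mu>) - ?V)) + ?m * ?m \<le> ?m * ?M'"
        using tube[OF \<mu>(1), of "P \<mu> (x \<mu>)"] m \<open>norm u = 1\<close> by (simp add: Py F_def)
      then have "?m * (u \<bullet> (F \<mu> (x \<mu>) - ?V) + ?m) \<le> ?m * ?M'" by (simp add: distrib_left)
      then have neg: "u \<bullet> (F \<mu> (x \<mu>) - ?V) - ?M' < 0" using m(1) by simp
      \<comment> \<open>\<open>u \<bullet> (x - v) - M\<close> minorises \<open>r\<close>, agrees with it at the maximum point \<open>\<mu>\<close> of \<open>r\<close>, and is decreasing there.\<close>
      have "has_nabla_derivative T (\<lambda>s. u \<bullet> (x s - v s) - M s) (u \<bullet> (F \<mu> (x \<mu>) - ?V) - ?M') \<mu>"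
        using \<mu>(1) \<open>norm u = 1\<close>
        by (intro has_nabla_derivative_diff has_nabla_derivative_inner_left KT x_deriv v M) auto
      from nabla_derivative_neg_imp_greater_left[OF KT[OF \<mu>(1)] \<open>a < \<mu>\<close> this neg]
      obtain s where "s \<in> T" "u \<bullet> ?y - ?m < u \<bullet> (x s - v s) - M s" .
      moreover have "u \<bullet> (x s - v s) \<le> norm (x s - v s)"
        using norm_cauchy_schwarz[of u "x s - v s"] \<open>norm u = 1\<close> by simp
      ultimately have "r \<mu> < r s" using uy by (simp add: r_def)
      then show False using max[OF \<open>s \<in> T\<close>] by simp
    qed
    moreover have "r t \<le> max (r a) (r \<mu>)"
      using \<mu>(2)[of t] nabla_domain_memI[OF that] a_le[OF that] by force
    ultimately show ?thesis using r_a by (simp add: r_def)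
  qed
  have Fx: "F t (x t) = f t (x t)" if "t \<in> ?K" for t
    using in_tube[OF KT[OF that]] M_pos[OF that] by (simp add: F_def P_def tube_proj_inside)
  have deriv: "nabla_differentiable T x t" "nabla_deriv T x t = F t (x t)" if "t \<in> ?K" for t
    using nabla_deriv_eqI[OF \<open>a < b\<close> that x_deriv[OF that]] by auto
  have "x a = x b"
  proof -
    have "norm (x b - v a) \<le> norm (x b - v b) + norm (v a - v b)"
      using norm_triangle_ineq4[of "x b - v b" "v a - v b"] by simp
    also have "\<dots> \<le> M a" using in_tube[OF b_in] tube_ab by simp
    finally show ?thesis using \<open>0 < M a\<close> by (simp add: x_a P_def tube_proj_inside)
  qed
  \<comment> \<open>The nabla derivative is \<open>F t (x t)\<close>, which is continuous on
    \<open>?K\<close> and hence ld-continuous.\<close>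
  moreover have "x \<in> C1_ld T UNIV"
    using deriv continuous_on_imp_ld_continuous_on[of ?K "nabla_deriv T x" T] Fx_cont
    by (simp add: C1_ld_def cong: continuous_on_cong)
  ultimately have "periodic_solution T a b f x"
    using deriv Fx by (simp add: periodic_solution_def)
  with in_tube show ?thesis by blast
qed

end
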